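(* Let $n\ge 1$ and $1\le k\le n$ be integers, and let $\mathcal V=\{V_1,\dots,V_N\}$ be any set of $N\ge 1$ $k$-dimensional linear subspaces of $\mathbb{R}^n$. Then \[ w_G\Big(B_H\big(\mathbf{S}_+^{n,k}(\mathcal V)^*\big)\Big)\;\le\;\sqrt{2k}+\sqrt{2\log N}. \]
   Context: $\mathbf S^n$ denotes the space of real symmetric $n\times n$ matrices with the trace inner product $\langle A,B\rangle=\mathrm{Tr}(AB)$. $H=\{X\in\mathbf S^n:\mathrm{Tr}\,X=1\}$. For a cone $\mathcal K\subseteq\mathbf S^n$, $B_H(\mathcal K):=(\mathcal K\cap H)-\tfrac1n I_n=\{X-\tfrac1nI_n: X\in\mathcal K\cap H\}$, and $\mathcal K^*=\{Y\in\mathbf S^n:\langle X,Y\rangle\ge 0\ \forall X\in\mathcal K\}$ is the dual cone. For $\mathcal V=\{V_1,\dots,V_N\}$ a set of $k$-dimensional subspaces of $\mathbb R^n$, the $k$-PSD approximation is the cone $\mathbf S_+^{n,k}(\mathcal V):=\{X\in\mathbf S^n: v^TXv\ge 0\ \forall v\in V_i,\ \forall i=1,\dots,N\}$. The standard Gaussian distribution on $\mathbf S^n$: a random matrix $G=(g_{ij})$ with $(g_{ij})_{i\le j}$ independent, $g_{ii}\sim N(0,1)$, $g_{ij}\sim N(0,1/2)$ for $i<j$. For a nonempty bounded set $S\subseteq\mathbf S^n$, its Gaussian width is $w_G(S)=\mathbb E_G\big[\sup_{X\in S}\langle G,X\rangle\big]$ with $G$ standard Gaussian in $\mathbf S^n$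 (this equals the Gaussian width computed in any linear subspace containing $S$ with its own standard Gaussian; $\log$ is the natural logarithm). *)

theory Defs
  imports "HOL-Analysis.Analysis" "HOL-Probability.Probability"
begin

definition symmat :: "(real^'n^'n) set" where
  "symmat = {X. transpose X = X}"

definition tr_inner :: "real^'n^'n \<Rightarrow> real^'n^'n \<Rightarrow> real" where
  "tr_inner A B = trace (A ** B)"

definition Hplane :: "(real^'n^'n) set" where
  "Hplane = {X \<in> symmat. trace X = 1}"

definition BH :: "(real^'n^'n) set \<Rightarrow> (real^'n^'n) set" where
  "BH K = (\<lambda>X. X - (1 / real CARD('n)) *\<^sub>R mat 1) ` (K \<inter> Hplane)"

definition dual_cone :: "(real^'n^'n) set \<Rightarrow> (real^'n^'n) set" where
  "dual_cone K = {Y \<in> symmat. \<forall>X\<in>K. tr_inner X Y \<ge> 0}"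

definition kpsd_approx :: "(real^'n) set set \<Rightarrow> (real^'n^'n) set" where
  "kpsd_approx \<V> = {X \<in> symmat. \<forall>V\<in>\<V>. \<forall>v\<in>V. v \<bullet> (X *v v) \<ge> 0}"

text \<open>Standard Gaussian distribution on S^n: independent entries g_{ij}, i \<le> j,
  indexed here by unordered pairs {i,j}; diagonal entries N(0,1), off-diagonal N(0,1/2).\<close>
definition sym_gauss_var :: "'n set \<Rightarrow> real" where
  "sym_gauss_var p = (if card p = 1 then 1 else 1/2)"

definition std_gauss_sym :: "(real^'n^'n) measure" where
  "std_gauss_sym =
     distr (PiM {p. \<exists>i j. p = {i, j}}
              (\<lambda>p. density lborel (normal_density 0 (sqrt (sym_gauss_var p)))))
           borel (\<lambda>g. \<chi> i j. g {i, j})"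

definition gauss_width_integrand :: "(real^'n^'n) set \<Rightarrow> real^'n^'n \<Rightarrow> real" where
  "gauss_width_integrand S G = (SUP X\<in>S. tr_inner G X)"

definition gauss_width :: "(real^'n^'n) set \<Rightarrow> real" where
  "gauss_width S = integral\<^sup>L std_gauss_sym (gauss_width_integrand S)"

end

theory Submission
  imports Defs "HOL-Real_Asymp.Real_Asymp"
begin

text \<open>
  Pairing a dual element of unit trace with \<open>m I - G\<close>, where \<open>m\<close> is the maximum of \<open>v\<^sup>T G v\<close> over unit
  vectors of the \<open>V\<^sub>i\<close>, shows that the supremum in the Gaussian width equals \<open>m - Tr G / n\<close>.
  For a single subspace, a Gaussian comparison of \<open>v\<^sup>T G v\<close> with \<open>sqrt 2 (v \<bullet> y)\<close>, \<open>y\<close> standard Gaussian in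
  \<open>V\<^sub>i\<close>, bounds the exponential moments: \<open>E exp (t m\<^sub>i) \<le> exp (t sqrt (2 k) + t\<^sup>2 / 2)\<close>. Summing over the \<open>N\<close>
  subspaces gives \<open>E m \<le> sqrt (2 k) + t / 2 + ln N / t\<close>, and \<open>t = sqrt (2 ln N)\<close> is optimal. The
  comparison is made for finite sets of vectors and extended to the sphere by dominated convergence
  along a dense sequence.
\<close>

section \<open>Univariate Gaussian integrals\<close>

text \<open>Mean bounds \<open>E m_i \<le> sqrt (2 k)\<close> alone would not control a maximum over
  \<open>N\<close> subspaces, so an exponential moment with variance proxy 1 is sought, 1 being the
  variance of \<open>v^T G v\<close> at a unit vector. The comparison process has variance 2
  instead. Its maximum over unit vectors is at most \<open>sqrt 2 |y|\<close>, whose exponential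
  moment at \<open>t\<close> is at most \<open>exp (t sqrt (2 k) + t^2)\<close>; the comparison
  repays the surplus variance with the factor \<open>exp (- t^2 / 2)\<close>, and
  \<open>t^2 / 2\<close> is left. The scale \<open>sqrt 2\<close> comes from the covariances: with
  \<open>u = v \<bullet> w\<close>, the gap \<open>c u - u^2\<close> is largest on [-1, 1] at
  \<open>u = 1\<close> exactly when \<open>c \<ge> 2\<close>, and the comparison needs the largest
  gap on the diagonal. A maximum is not differentiable, so the interpolation runs on the smooth
  surrogate \<open>(\<Sum>v. exp (\<beta> z v)) powr (t / \<beta>)\<close>, which tends to
  \<open>exp (t max z)\<close> as \<beta> grows. The surrogate is a finite sum, whence the detour
  through finite sets of vectors. The term \<open>Tr G / n\<close> has mean zero and drops out at
  the end.\<close>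

abbreviation centered_normal :: "real \<Rightarrow> real measure" where
  "centered_normal s \<equiv> density lborel (normal_density 0 s)"

text \<open>Completing the square: an exponential tilt only moves the mean, so integrability reduces
  to that of a normal density.\<close>

lemma normal_density_times_exp_linear:
  assumes "s > 0"
  shows "normal_density 0 s x * exp (c * x) = exp (c\<^sup>2 * s\<^sup>2 / 2) * normal_density (c * s\<^sup>2) s x"
proof -
  have "- (x\<^sup>2) / (2 * s\<^sup>2) + c * x = c\<^sup>2 * s\<^sup>2 / 2 + (- (x - c * s\<^sup>2)\<^sup>2 / (2 * s\<^sup>2))"
    using assms by (simp add: field_simps power2_eq_square)
  then have "exp (- (x\<^sup>2) / (2 * s\<^sup>2)) * exp (c * x) = exp (c\<^sup>2 * s\<^sup>2 / 2) * exp (- (x - c * s\<^sup>2)\<^sup>2 / (2 * s\<^sup>2))"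
    by (metis exp_add)
  then show ?thesis
    by (simp add: normal_density_def field_simps)
qed

lemma integrable_centered_normal_exp:
  assumes "s > 0"
  shows "integrable (centered_normal s) (\<lambda>x. exp (c * x))"
  using assms by (subst integrable_density) (auto simp: normal_density_times_exp_linear)

text \<open>Growth at most exponential in \<open>\<bar>x\<bar>\<close> is the class used for
  integration by parts: it absorbs a factor \<open>x\<close> and is beaten by the Gaussian
  tail.\<close>

lemma integrable_centered_normal_exp_abs:
  assumes "s > 0"
  shows "integrable (centered_normal s) (\<lambda>x. exp (c * \<bar>x\<bar>))"
proof (rule Bochner_Integration.integrable_bound)
  show "integrable (centered_normal s) (\<lambda>x. exp (c * x) + exp ((-c) * x))"
    using assms by (intro Bochner_Integration.integrable_add integrable_centered_normal_exp)
  have "exp (c * \<bar>x\<bar>) \<le> exp (c * x) + exp (- c * x)" for x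
    by (cases "x \<ge> 0") auto
  then show "AE x in centered_normal s. norm (exp (c * \<bar>x\<bar>)) \<le> norm (exp (c * x) + exp (- c * x))"
    by (intro AE_I2) (metis abs_exp_cancel abs_ge_self order_trans real_norm_def)
qed simp

text \<open>A quadratic tilt changes the variance from 1 to \<open>1 / (1 - q)\<close>; the integral
  is the ratio of the two normalizing constants.\<close>

lemma normal_mean_exp_square:
  assumes "q < 1"
  shows "integrable (centered_normal 1) (\<lambda>x. exp (q * x\<^sup>2 / 2))"
    and "(\<integral>x. exp (q * x\<^sup>2 / 2) \<partial>centered_normal 1) = 1 / sqrt (1 - q)"
proof -
  define r where "r = 1 / sqrt (1 - q)"
  have r: "r > 0" "r\<^sup>2 = 1 / (1 - q)" using assms by (auto simp: r_def power_divide)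
  have eq: "normal_density 0 1 x * exp (q * x\<^sup>2 / 2) = r * normal_density 0 r x" for x
  proof -
    have "- x\<^sup>2 / 2 + q * x\<^sup>2 / 2 = - x\<^sup>2 / (2 * r\<^sup>2)"
      unfolding r using assms by (simp add: field_simps)
    then have "exp (- x\<^sup>2 / 2) * exp (q * x\<^sup>2 / 2) = exp (- x\<^sup>2 / (2 * r\<^sup>2))"
      by (metis exp_add)
    moreover have "sqrt (2 * pi * r\<^sup>2) = r * sqrt (2 * pi)"
      using r(1) by (simp add: real_sqrt_mult)
    ultimately show ?thesis
      using r(1) by (simp add: normal_density_def)
  qed
  show "integrable (centered_normal 1) (\<lambda>x. exp (q * x\<^sup>2 / 2))"
    using r by (subst integrable_density) (auto simp: eq)
  show "(\<integral>x. exp (q * x\<^sup>2 / 2) \<partial>centered_normal 1) = 1 / sqrt (1 - q)"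
    using r by (subst integral_density) (auto simp: eq r_def)
qed

text \<open>Stein's identity. The density has derivative \<open>- (y / s\<^sup>2)\<close> times
  itself, so density times \<open>u\<close> is an antiderivative of the difference of the two
  integrands, and it vanishes at both ends.\<close>

lemma normal_integration_by_parts:
  fixes u u' :: "real \<Rightarrow> real"
  assumes s: "s > 0"
    and deriv: "\<And>y. (u has_real_derivative u' y) (at y)"
    and cont: "continuous_on UNIV u'"
    and bound: "\<And>y. \<bar>u y\<bar> \<le> C * exp (c * \<bar>y\<bar>)" "\<And>y. \<bar>u' y\<bar> \<le> C * exp (c * \<bar>y\<bar>)"
  shows "(\<integral>y. y * u y \<partial>centered_normal s) = s\<^sup>2 * (\<integral>y. u' y \<partial>centered_normal s)"
proof -
  let ?N = "centered_normal s" and ?d = "normal_density 0 s"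
  have C: "C \<ge> 0" using bound(1)[of 0] abs_ge_zero[of "u 0"] by simp
  have ucont: "continuous_on UNIV u"
    using deriv by (meson DERIV_isCont continuous_at_imp_continuous_on)
  have [measurable]: "u \<in> borel_measurable borel" "u' \<in> borel_measurable borel"
    using cont ucont by (auto intro: borel_measurable_continuous_onI)
  have i1: "integrable ?N u'"
    by (rule Bochner_Integration.integrable_bound
          [OF integrable_mult_right[OF integrable_centered_normal_exp_abs[OF s], of C c]])
       (use bound C in \<open>auto simp: abs_mult\<close>)
  have i2: "integrable ?N (\<lambda>y. y * u y)"
  proof (rule Bochner_Integration.integrable_bound)
    show "integrable ?N (\<lambda>y. C * exp ((c + 1) * \<bar>y\<bar>))"
      by (intro integrable_mult_right integrable_centered_normal_exp_abs s)
    have "\<bar>y * u y\<bar> \<le> C * exp ((c + 1) * \<bar>y\<bar>)" for y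
    proof -
      have "\<bar>y\<bar> \<le> exp \<bar>y\<bar>" using exp_ge_add_one_self[of "\<bar>y\<bar>"] by linarith
      then have "\<bar>y\<bar> * \<bar>u y\<bar> \<le> exp \<bar>y\<bar> * (C * exp (c * \<bar>y\<bar>))"
        using bound(1)[of y] by (intro mult_mono) auto
      then show ?thesis by (simp add: abs_mult exp_add algebra_simps)
    qed
    then show "AE y in ?N. norm (y * u y) \<le> norm (C * exp ((c + 1) * \<bar>y\<bar>))"
      using C by (auto simp: abs_mult)
  qed simp
  define f where "f y = ?d y * u' y - ?d y * (y * u y) / s\<^sup>2" for y
  have dd: "(?d has_real_derivative - (y / s\<^sup>2) * ?d y) (at y)" for y
    unfolding normal_density_def using s
    by (auto intro!: derivative_eq_intros simp: field_simps power2_eq_square)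
  have i1': "integrable lborel (\<lambda>y. ?d y * u' y)"
    using i1 by (subst (asm) integrable_density) auto
  have i2': "integrable lborel (\<lambda>y. ?d y * (y * u y))"
    using i2 by (subst (asm) integrable_density) auto
  have fi: "integrable lborel f"
    unfolding f_def by (intro Bochner_Integration.integrable_diff i1' integrable_divide_zero i2' impI)
  have der: "((\<lambda>y. ?d y * u y) has_real_derivative f y) (at y)" for y
    using DERIV_mult[OF dd[of y] deriv[of y]] by (simp add: f_def algebra_simps)
  have lim: "((\<lambda>y. ?d y * u y) \<longlongrightarrow> 0) at_bot" "((\<lambda>y. ?d y * u y) \<longlongrightarrow> 0) at_top"
  proof -
    have b: "norm (?d y * u y) \<le> ?d y * (C * exp (c * \<bar>y\<bar>))" for y
      using bound(1)[of y] by (auto simp: abs_mult intro!: mult_left_mono)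
    define q where "q = 1 / (2 * s\<^sup>2)"
    have q: "q > 0" using s by (simp add: q_def)
    have "?d y * (C * exp (c * \<bar>y\<bar>)) = C / sqrt (2 * pi * s\<^sup>2) * exp (c * \<bar>y\<bar> - q * y\<^sup>2)" for y
      by (simp add: normal_density_def q_def exp_diff exp_minus field_simps)
    moreover have "((\<lambda>y::real. exp (c * \<bar>y\<bar> - q * y\<^sup>2)) \<longlongrightarrow> 0) at_top"
      "((\<lambda>y::real. exp (c * \<bar>y\<bar> - q * y\<^sup>2)) \<longlongrightarrow> 0) at_bot"
      using q by real_asymp+
    ultimately have "((\<lambda>y. ?d y * (C * exp (c * \<bar>y\<bar>))) \<longlongrightarrow> 0) at_top"
      "((\<lambda>y. ?d y * (C * exp (c * \<bar>y\<bar>))) \<longlongrightarrow> 0) at_bot"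
      by (simp_all only: tendsto_mult_right_zero)
    then show "((\<lambda>y. ?d y * u y) \<longlongrightarrow> 0) at_bot" "((\<lambda>y. ?d y * u y) \<longlongrightarrow> 0) at_top"
      using b by (metis (no_types, lifting) Lim_null_comparison always_eventually)+
  qed
  have "(LBINT y=-\<infinity>..\<infinity>. f y) = 0 - 0"
  proof (rule interval_integral_FTC_integrable)
    show "((\<lambda>y. ?d y * u y) has_vector_derivative f x) (at x)" for x
      using der[of x] by (simp add: has_real_derivative_iff_has_vector_derivative)
    show "isCont f x" for x
      unfolding f_def using DERIV_isCont[OF dd] DERIV_isCont[OF deriv] cont s
      by (auto intro!: continuous_intros simp: continuous_on_eq_continuous_at)
    show "set_integrable lborel (einterval (-\<infinity>) \<infinity>) f"
      using fi by (simp add: set_integrable_def)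
    show "(((\<lambda>y. ?d y * u y) \<circ> real_of_ereal) \<longlongrightarrow> 0) (at_right (-\<infinity>))"
      "(((\<lambda>y. ?d y * u y) \<circ> real_of_ereal) \<longlongrightarrow> 0) (at_left \<infinity>)"
      using lim by (simp_all only: ereal_tendsto_simps)
  qed simp
  then have "integral\<^sup>L lborel f = 0"
    by (simp add: interval_lebesgue_integral_def set_lebesgue_integral_def)
  moreover have "integral\<^sup>L lborel f = (\<integral>y. ?d y * u' y \<partial>lborel) - (\<integral>y. ?d y * (y * u y) \<partial>lborel) / s\<^sup>2"
    unfolding f_def by (subst Bochner_Integration.integral_diff) (auto intro: i1' i2')
  ultimately show ?thesis
    using s by (subst (1 2) integral_density) (auto simp: field_simps)
qed

section \<open>Gaussian vectors with independent coordinates\<close>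

locale gaussian_vector =
  fixes I :: "'i set" and s :: "'i \<Rightarrow> real"
  assumes finite_I: "finite I" and s_pos: "\<And>i. s i > 0"
begin

abbreviation N :: "'i \<Rightarrow> real measure" where "N i \<equiv> centered_normal (s i)"
abbreviation M :: "('i \<Rightarrow> real) measure" where "M \<equiv> PiM I N"

sublocale N: prob_space "N i" for i
  by (rule prob_space_normal_density) (rule s_pos)

sublocale product_prob_space N I ..

sublocale finite_product_prob_space N I
  by standard (rule finite_I)

text \<open>The l1 norm is chosen for domination because its exponential factorizes over the
  independent coordinates.\<close>

lemma integrable_exp_l1: "integrable M (\<lambda>x. exp (c * (\<Sum>i\<in>I. \<bar>x i\<bar>)))"
  using product_integrable_prod[of I "\<lambda>i y. exp (c * \<bar>y\<bar>)"]
  by (simp add: finite_I integrable_centered_normal_exp_abs s_pos sum_distrib_left exp_sum)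

lemma integrable_exp_bound:
  fixes f :: "('i \<Rightarrow> real) \<Rightarrow> real"
  assumes "f \<in> borel_measurable M" and "\<And>x. \<bar>f x\<bar> \<le> C * exp (c * (\<Sum>i\<in>I. \<bar>x i\<bar>))"
  shows "integrable M f"
proof (rule Bochner_Integration.integrable_bound)
  show "integrable M (\<lambda>x. C * exp (c * (\<Sum>i\<in>I. \<bar>x i\<bar>)))"
    by (intro integrable_mult_right integrable_exp_l1)
  show "AE x in M. norm (f x) \<le> norm (C * exp (c * (\<Sum>i\<in>I. \<bar>x i\<bar>)))"
    using assms(2) by (intro AE_I2) (metis abs_of_nonneg abs_ge_zero order_trans real_norm_def)
qed fact

text \<open>A factor \<open>x i\<close> costs one unit in the exponent, since a number is at most
  its exponential.\<close>

lemma abs_coordinate_mult_exp_bound: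
  assumes "i \<in> I" and "\<bar>u\<bar> \<le> C * exp (c * (\<Sum>i\<in>I. \<bar>x i\<bar>))"
  shows "\<bar>x i * u\<bar> \<le> C * exp ((c + 1) * (\<Sum>i\<in>I. \<bar>x i :: real\<bar>))"
proof -
  let ?S = "\<Sum>i\<in>I. \<bar>x i\<bar>"
  have "\<bar>x i\<bar> \<le> ?S" using assms(1) finite_I by (intro member_le_sum) auto
  also have "\<dots> \<le> exp ?S" using exp_ge_add_one_self[of ?S] by linarith
  finally have "\<bar>x i\<bar> * \<bar>u\<bar> \<le> exp ?S * (C * exp (c * ?S))"
    using assms(2) by (intro mult_mono) auto
  then show ?thesis by (simp add: abs_mult exp_add algebra_simps)
qed

text \<open>Fubini isolates coordinate \<open>i\<close>, and Stein's identity applies to it with the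
  others frozen.\<close>

lemma integration_by_parts:
  fixes h h' :: "('i \<Rightarrow> real) \<Rightarrow> real"
  assumes i: "i \<in> I"
    and meas: "h \<in> borel_measurable M" "h' \<in> borel_measurable M"
    and deriv: "\<And>x. ((\<lambda>y. h (x(i := y))) has_real_derivative h' x) (at (x i))"
    and cont: "\<And>x. continuous_on UNIV (\<lambda>y. h' (x(i := y)))"
    and bound: "\<And>x. \<bar>h x\<bar> \<le> C * exp (c * (\<Sum>i\<in>I. \<bar>x i\<bar>))"
      "\<And>x. \<bar>h' x\<bar> \<le> C * exp (c * (\<Sum>i\<in>I. \<bar>x i\<bar>))"
  shows "(\<integral>x. x i * h x \<partial>M) = (s i)\<^sup>2 * (\<integral>x. h' x \<partial>M)"
proof -
  let ?J = "I - {i}"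
  have I: "insert i ?J = I" and J: "finite ?J" "i \<notin> ?J" using i finite_I by auto
  have i1: "integrable M (\<lambda>x. x i * h x)"
    by (rule integrable_exp_bound[where C=C and c="c + 1"])
       (use i meas bound in \<open>auto intro!: abs_coordinate_mult_exp_bound\<close>)
  have i2: "integrable M h'"
    by (rule integrable_exp_bound[OF meas(2) bound(2)])
  have inner: "(\<integral>y. y * h (x(i := y)) \<partial>N i) = (s i)\<^sup>2 * (\<integral>y. h' (x(i := y)) \<partial>N i)" for x
  proof (rule normal_integration_by_parts[OF s_pos])
    show "((\<lambda>y. h (x(i := y))) has_real_derivative h' (x(i := y))) (at y)" for y
      using deriv[of "x(i := y)"] by simp
    have *: "C * exp (c * (\<Sum>j\<in>I. \<bar>(x(i := y)) j\<bar>))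
        = C * exp (c * (\<Sum>j\<in>?J. \<bar>x j\<bar>)) * exp (c * \<bar>y\<bar>)" for y
    proof -
      have "(\<Sum>j\<in>I. \<bar>(x(i := y)) j\<bar>) = \<bar>y\<bar> + (\<Sum>j\<in>?J. \<bar>x j\<bar>)"
        using i finite_I by (simp add: sum.remove[of I i])
      then show ?thesis by (simp add: exp_add algebra_simps)
    qed
    show "\<bar>h (x(i := y))\<bar> \<le> C * exp (c * (\<Sum>j\<in>?J. \<bar>x j\<bar>)) * exp (c * \<bar>y\<bar>)"
      "\<bar>h' (x(i := y))\<bar> \<le> C * exp (c * (\<Sum>j\<in>?J. \<bar>x j\<bar>)) * exp (c * \<bar>y\<bar>)" for y
      using bound[of "x(i := y)"] unfolding * .
  qed (rule cont)
  have "(\<integral>x. x i * h x \<partial>M) = (\<integral>x. (\<integral>y. y * h (x(i := y)) \<partial>N i) \<partial>PiM ?J N)"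
    using product_integral_insert[OF J, of "\<lambda>x. x i * h x"] i1 unfolding I by simp
  also have "\<dots> = (s i)\<^sup>2 * (\<integral>x. (\<integral>y. h' (x(i := y)) \<partial>N i) \<partial>PiM ?J N)"
    unfolding inner by simp
  also have "\<dots> = (s i)\<^sup>2 * (\<integral>x. h' x \<partial>M)"
    using product_integral_insert[OF J, of h'] i2 unfolding I by simp
  finally show ?thesis .
qed

end

text \<open>By the mean value theorem the bound \<open>g\<close> on all derivatives also bounds
  every difference quotient, so dominated convergence applies along each sequence tending to
  \<open>t0\<close>.\<close>

lemma has_real_derivative_lebesgue_integral:
  fixes f f' :: "real \<Rightarrow> 'a \<Rightarrow> real"
  assumes int: "\<And>t. integrable M (f t)"
    and meas: "f' t0 \<in> borel_measurable M"
    and deriv: "\<And>t x. ((\<lambda>t. f t x) has_real_derivative f' t x) (at t)"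
    and bound: "\<And>t x. \<bar>f' t x\<bar> \<le> g x" and g: "integrable M g"
  shows "((\<lambda>t. \<integral>x. f t x \<partial>M) has_real_derivative (\<integral>x. f' t0 x \<partial>M)) (at t0)"
  unfolding has_field_derivative_iff tendsto_at_iff_sequentially
proof (intro allI impI)
  fix X :: "nat \<Rightarrow> real" assume X: "\<forall>i. X i \<in> UNIV - {t0}" "X \<longlonglongrightarrow> t0"
  let ?q = "\<lambda>n x. (f (X n) x - f t0 x) / (X n - t0)"
  have lip: "\<bar>f t x - f u x\<bar> \<le> g x * \<bar>t - u\<bar>" for t u x
    using field_differentiable_bound[of UNIV "\<lambda>t. f t x" "\<lambda>t. f' t x" "g x" t u] deriv bound
    by (auto simp: has_field_derivative_at_within)
  have "(\<lambda>n. \<integral>x. ?q n x \<partial>M) \<longlonglongrightarrow> (\<integral>x. f' t0 x \<partial>M)"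
  proof (rule integral_dominated_convergence[OF meas _ g])
    show "?q n \<in> borel_measurable M" for n using int by (auto dest: borel_measurable_integrable)
    show "AE x in M. (\<lambda>n. ?q n x) \<longlonglongrightarrow> f' t0 x"
    proof (intro AE_I2)
      fix x
      have "((\<lambda>t. (f t x - f t0 x) / (t - t0)) \<longlongrightarrow> f' t0 x) (at t0)"
        using deriv[of x t0] by (simp add: has_field_derivative_iff)
      then show "(\<lambda>n. ?q n x) \<longlonglongrightarrow> f' t0 x"
        using X unfolding tendsto_at_iff_sequentially comp_def by auto
    qed
    show "AE x in M. norm (?q n x) \<le> g x" for n
    proof (intro AE_I2)
      fix x have "X n \<noteq> t0" using X(1) by auto
      then show "norm (?q n x) \<le> g x"
        using lip[of "X n" x t0] by (simp add: abs_divide pos_divide_le_eq)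
    qed
  qed
  moreover have "(\<integral>x. ?q n x \<partial>M) = ((\<integral>x. f (X n) x \<partial>M) - (\<integral>x. f t0 x \<partial>M)) / (X n - t0)" for n
    by (simp only: integral_divide_zero Bochner_Integration.integral_diff[OF int int])
  ultimately show "((\<lambda>t. ((\<integral>x. f t x \<partial>M) - (\<integral>x. f t0 x \<partial>M)) / (t - t0)) \<circ> X) \<longlonglongrightarrow> (\<integral>x. f' t0 x \<partial>M)"
    by (simp only: comp_def)
qed

section \<open>Gaussian comparison of exponential moments\<close>

context gaussian_vector
begin

text \<open>A Slepian-type interpolation along \<open>z \<theta> v = cos \<theta> (a v \<bullet> x) + sin \<theta> (b v \<bullet> x)\<close>. The test
  function \<open>(\<Sum>v. exp (\<beta> z v)) powr (t / \<beta>)\<close> has nonpositive mixed second derivatives because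
  \<open>t \<le> \<beta>\<close>, and all its second derivatives add up to \<open>t\<^sup>2\<close> times itself; hence the factor
  \<open>exp (- K t\<^sup>2 / 2)\<close> when the covariance gap \<open>\<kappa>\<close> is at most \<open>K\<close> with equality on the diagonal.\<close>

lemma exponential_comparison:
  fixes S :: "'v set" and a b :: "'v \<Rightarrow> 'i \<Rightarrow> real"
  defines "\<kappa> \<equiv> \<lambda>v w. (\<Sum>i\<in>I. (s i)\<^sup>2 * (b v i * b w i)) - (\<Sum>i\<in>I. (s i)\<^sup>2 * (a v i * a w i))"
  assumes S: "finite S" "S \<noteq> {}" and t: "0 < t" "t \<le> \<beta>"
    and orth: "\<And>v w. v \<in> S \<Longrightarrow> w \<in> S \<Longrightarrow> (\<Sum>i\<in>I. (s i)\<^sup>2 * (a v i * b w i)) = 0"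
    and le: "\<And>v w. v \<in> S \<Longrightarrow> w \<in> S \<Longrightarrow> \<kappa> v w \<le> K"
    and diag: "\<And>v. v \<in> S \<Longrightarrow> \<kappa> v v = K"
  shows "(\<integral>x. (\<Sum>v\<in>S. exp (\<beta> * (\<Sum>i\<in>I. a v i * x i))) powr (t / \<beta>) \<partial>M)
    \<le> exp (- (K * t\<^sup>2 / 2)) * (\<integral>x. (\<Sum>v\<in>S. exp (\<beta> * (\<Sum>i\<in>I. b v i * x i))) powr (t / \<beta>) \<partial>M)"
proof -
  define p where "p = t / \<beta>"
  have \<beta>: "\<beta> > 0" and p: "0 < p" "p \<le> 1" "p * \<beta> = t" using t by (auto simp: p_def)
  define m where "m \<theta> v i = cos \<theta> * a v i + sin \<theta> * b v i" for \<theta> v i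
  define m' where "m' \<theta> v i = cos \<theta> * b v i - sin \<theta> * a v i" for \<theta> v i
  define z where "z \<theta> v x = (\<Sum>i\<in>I. m \<theta> v i * x i)" for \<theta> v and x :: "'i \<Rightarrow> real"
  define z' where "z' \<theta> v x = (\<Sum>i\<in>I. m' \<theta> v i * x i)" for \<theta> v and x :: "'i \<Rightarrow> real"
  define W where "W \<theta> x = (\<Sum>v\<in>S. exp (\<beta> * z \<theta> v x))" for \<theta> x
  \<comment> \<open>\<open>t * H \<theta> v x\<close> is the derivative of
    \<open>W \<theta> x powr p\<close> in the variable \<open>z \<theta> v x\<close>.
    \<open>H'\<close> is the derivative of \<open>H\<close> in the coordinate \<open>x i\<close>,
    with \<open>Q\<close> produced by the factor \<open>W \<theta> x powr (p - 1)\<close>.\<close>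
  define H where "H \<theta> v x = W \<theta> x powr (p - 1) * exp (\<beta> * z \<theta> v x)" for \<theta> v x
  define Q where "Q \<theta> v w x = W \<theta> x powr (p - 2) * exp (\<beta> * z \<theta> v x) * exp (\<beta> * z \<theta> w x)" for \<theta> v w x
  define H' where "H' \<theta> v i x = \<beta> * (m \<theta> v i * H \<theta> v x - (1 - p) * (\<Sum>w\<in>S. m \<theta> w i * Q \<theta> v w x))" for \<theta> v i x
  define L where "L x = (\<Sum>i\<in>I. \<bar>x i\<bar>)" for x :: "'i \<Rightarrow> real"
  \<comment> \<open>Coarse bounds uniform in the angle: \<open>D\<close> dominates every coefficient
    of \<open>z\<close> and \<open>z'\<close>, and \<open>W powr p\<close> is then at most
    \<open>C * exp (c * L x)\<close>, with \<open>c = t * D\<close> because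
    \<open>p * \<beta> = t\<close>.\<close>
  define D where "D = (\<Sum>v\<in>S. \<Sum>i\<in>I. \<bar>a v i\<bar> + \<bar>b v i\<bar>)"
  define C where "C = real (card S) powr p"
  define c where "c = t * D"

  have D0: "D \<ge> 0" unfolding D_def by (intro sum_nonneg) auto
  have C0: "C \<ge> 0" unfolding C_def by simp
  have L0: "L x \<ge> 0" for x unfolding L_def by (intro sum_nonneg) auto
  have abD: "\<bar>a v i\<bar> + \<bar>b v i\<bar> \<le> D" if "v \<in> S" "i \<in> I" for v i
  proof -
    have "\<bar>a v i\<bar> + \<bar>b v i\<bar> \<le> (\<Sum>i\<in>I. \<bar>a v i\<bar> + \<bar>b v i\<bar>)"
      using that finite_I by (intro member_le_sum[of i I "\<lambda>i. \<bar>a v i\<bar> + \<bar>b v i\<bar>"]) auto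
    also have "\<dots> \<le> D"
      unfolding D_def using that S(1)
      by (intro member_le_sum[of v S "\<lambda>v. \<Sum>i\<in>I. \<bar>a v i\<bar> + \<bar>b v i\<bar>"]) (auto intro!: sum_nonneg)
    finally show ?thesis .
  qed
  have shrink: "\<bar>e * y\<bar> \<le> \<bar>y\<bar>" if "\<bar>e\<bar> \<le> 1" for e y :: real
    using mult_right_mono[OF that, of "\<bar>y\<bar>"] by (simp add: abs_mult)
  have mD: "\<bar>m \<theta> v i\<bar> \<le> D" "\<bar>m' \<theta> v i\<bar> \<le> D" if "v \<in> S" "i \<in> I" for \<theta> v i
    using abD[OF that] shrink[OF abs_cos_le_one[of \<theta>], of "a v i"]
      shrink[OF abs_sin_le_one[of \<theta>], of "b v i"] shrink[OF abs_sin_le_one[of \<theta>], of "a v i"]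
      shrink[OF abs_cos_le_one[of \<theta>], of "b v i"]
    unfolding m_def m'_def by linarith+
  have zD: "\<bar>\<Sum>i\<in>I. n i * x i\<bar> \<le> D * L x" if "\<And>i. i \<in> I \<Longrightarrow> \<bar>n i\<bar> \<le> D" for n x
  proof -
    have "\<bar>\<Sum>i\<in>I. n i * x i\<bar> \<le> (\<Sum>i\<in>I. D * \<bar>x i\<bar>)"
      using that by (intro order.trans[OF sum_abs] sum_mono) (auto simp: abs_mult intro: mult_right_mono)
    then show ?thesis by (simp add: L_def sum_distrib_left)
  qed
  have W0: "W \<theta> x > 0" for \<theta> x
    unfolding W_def using S by (intro sum_pos) auto
  have H0: "H \<theta> v x \<ge> 0" "Q \<theta> v w x \<ge> 0" for \<theta> v w x
    unfolding H_def Q_def by auto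
  \<comment> \<open>Summing out an index collapses \<open>Q\<close> to \<open>H\<close> and
    \<open>H\<close> to the test function; this turns a constant gap \<open>K\<close> into a
    multiple of \<open>W powr p\<close>.\<close>
  have HW: "(\<Sum>v\<in>S. H \<theta> v x) = W \<theta> x powr p" for \<theta> x
  proof -
    have "(\<Sum>v\<in>S. H \<theta> v x) = W \<theta> x powr (p - 1) * W \<theta> x powr 1"
      unfolding H_def using W0[of \<theta> x] by (simp add: sum_distrib_left[symmetric] W_def[symmetric])
    also have "\<dots> = W \<theta> x powr p"
      by (subst powr_add[symmetric]) simp
    finally show ?thesis .
  qed
  have QH: "(\<Sum>w\<in>S. Q \<theta> v w x) = H \<theta> v x" for \<theta> v x
  proof -
    have "(\<Sum>w\<in>S. Q \<theta> v w x) = W \<theta> x powr (p - 2) * W \<theta> x powr 1 * exp (\<beta> * z \<theta> v x)"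
      unfolding Q_def using W0[of \<theta> x] by (simp add: sum_distrib_left[symmetric] W_def[symmetric])
    also have "W \<theta> x powr (p - 2) * W \<theta> x powr 1 = W \<theta> x powr (p - 1)"
      by (subst powr_add[symmetric]) simp
    finally show ?thesis by (simp add: H_def)
  qed
  have WC: "W \<theta> x powr p \<le> C * exp (c * L x)" for \<theta> x
  proof -
    have "z \<theta> v x \<le> D * L x" if "v \<in> S" for v
      using zD[of "m \<theta> v" x] mD that by (auto simp: z_def)
    then have "W \<theta> x \<le> (\<Sum>v\<in>S. exp (\<beta> * (D * L x)))"
      unfolding W_def using \<beta> by (intro sum_mono) (auto intro!: mult_left_mono)
    then have "W \<theta> x powr p \<le> (real (card S) * exp (\<beta> * (D * L x))) powr p"
      using p W0[of \<theta> x] by (intro powr_mono2) auto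
    also have "\<dots> = C * exp (c * L x)"
      using p by (simp add: C_def c_def powr_mult exp_powr_real mult_ac)
    finally show ?thesis .
  qed
  have HC: "H \<theta> v x \<le> C * exp (c * L x)" if "v \<in> S" for \<theta> v x
  proof -
    have "H \<theta> v x \<le> (\<Sum>v\<in>S. H \<theta> v x)"
      using S that H0 by (intro member_le_sum) auto
    then show ?thesis using HW WC order.trans by metis
  qed
  have H'C: "\<bar>H' \<theta> v i x\<bar> \<le> (2 * \<beta> * D * C) * exp (c * L x)" if v: "v \<in> S" and i: "i \<in> I" for \<theta> v i x
  proof -
    have "\<bar>\<Sum>w\<in>S. m \<theta> w i * Q \<theta> v w x\<bar> \<le> (\<Sum>w\<in>S. D * Q \<theta> v w x)"
      using mD i H0 by (intro order.trans[OF sum_abs] sum_mono) (auto simp: abs_mult intro!: mult_right_mono)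
    also have "\<dots> = D * H \<theta> v x" by (simp add: QH flip: sum_distrib_left)
    finally have "\<bar>(1 - p) * (\<Sum>w\<in>S. m \<theta> w i * Q \<theta> v w x)\<bar> \<le> D * H \<theta> v x"
      using shrink[of "1 - p" "\<Sum>w\<in>S. m \<theta> w i * Q \<theta> v w x"] p by linarith
    moreover have "\<bar>m \<theta> v i * H \<theta> v x\<bar> \<le> D * H \<theta> v x"
      using mD[OF v i] H0 by (auto simp: abs_mult intro!: mult_right_mono)
    ultimately have "\<bar>H' \<theta> v i x\<bar> \<le> \<beta> * (2 * D * H \<theta> v x)"
      unfolding H'_def abs_mult[of \<beta>] using \<beta> by (intro mult_mono) auto
    also have "\<dots> \<le> \<beta> * (2 * D * (C * exp (c * L x)))"
      using \<beta> D0 HC[OF v] by (intro mult_left_mono) auto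
    finally show ?thesis by (simp add: mult_ac)
  qed

  have [measurable]: "z \<theta> v \<in> borel_measurable M" "z' \<theta> v \<in> borel_measurable M" for \<theta> v
    unfolding z_def z'_def by measurable
  have [measurable]: "W \<theta> \<in> borel_measurable M" for \<theta>
    unfolding W_def by measurable
  have [measurable]: "H \<theta> v \<in> borel_measurable M" "Q \<theta> v w \<in> borel_measurable M" for \<theta> v w
    unfolding H_def Q_def by measurable
  have [measurable]: "H' \<theta> v i \<in> borel_measurable M" for \<theta> v i
    unfolding H'_def by measurable

  have zi: "((\<lambda>y. z \<theta> v (x(i := y))) has_real_derivative m \<theta> v i) (at y0)" if i: "i \<in> I" for \<theta> v i x y0
  proof -
    have "(\<lambda>y. z \<theta> v (x(i := y))) = (\<lambda>y. m \<theta> v i * y + (\<Sum>j\<in>I - {i}. m \<theta> v j * x j))"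
      unfolding z_def using i finite_I by (auto simp: sum.remove[of I i])
    then show ?thesis by (auto intro!: derivative_eq_intros)
  qed
  have zic: "continuous_on UNIV (\<lambda>y. z \<theta> v (x(i := y)))" if "i \<in> I" for \<theta> v i x
    using zi[OF that] by (meson DERIV_isCont continuous_at_imp_continuous_on)
  have Wne: "W \<theta> x \<noteq> 0" for \<theta> x using W0[of \<theta> x] by simp

  have ibp: "(\<integral>x. x i * H \<theta> v x \<partial>M) = (s i)\<^sup>2 * (\<integral>x. H' \<theta> v i x \<partial>M)" if v: "v \<in> S" and i: "i \<in> I" for \<theta> v i
  proof (rule integration_by_parts[where C="max C (2 * \<beta> * D * C)" and c=c, OF i])
    show "((\<lambda>y. H \<theta> v (x(i := y))) has_real_derivative H' \<theta> v i x) (at (x i))" for x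
    proof -
      have dW: "((\<lambda>y. W \<theta> (x(i := y))) has_real_derivative (\<Sum>w\<in>S. exp (\<beta> * z \<theta> w x) * (\<beta> * m \<theta> w i))) (at (x i))"
        unfolding W_def by (auto intro!: derivative_eq_intros zi i simp: mult_ac)
      have de: "((\<lambda>y. exp (\<beta> * z \<theta> v (x(i := y)))) has_real_derivative exp (\<beta> * z \<theta> v x) * (\<beta> * m \<theta> v i)) (at (x i))"
        by (auto intro!: derivative_eq_intros zi i simp: mult_ac)
      have "((\<lambda>y. H \<theta> v (x(i := y))) has_real_derivative
          W \<theta> x powr (p - 1) * (exp (\<beta> * z \<theta> v x) * (\<beta> * m \<theta> v i)) +
          (p - 1) * W \<theta> x powr (p - 2) * (\<Sum>w\<in>S. exp (\<beta> * z \<theta> w x) * (\<beta> * m \<theta> w i)) * exp (\<beta> * z \<theta> v x)) (at (x i))"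
        unfolding H_def using DERIV_mult[OF DERIV_fun_powr[OF dW, of "p - 1"] de] W0[of \<theta> x]
        by (simp add: add.commute mult.commute)
      moreover have "W \<theta> x powr (p - 1) * (exp (\<beta> * z \<theta> v x) * (\<beta> * m \<theta> v i)) +
          (p - 1) * W \<theta> x powr (p - 2) * (\<Sum>w\<in>S. exp (\<beta> * z \<theta> w x) * (\<beta> * m \<theta> w i)) * exp (\<beta> * z \<theta> v x)
          = H' \<theta> v i x"
        unfolding H'_def H_def Q_def by (simp add: sum_distrib_left sum_distrib_right sum_subtractf algebra_simps)
      ultimately show ?thesis by simp
    qed
    show "continuous_on UNIV (\<lambda>y. H' \<theta> v i (x(i := y)))" for x
      unfolding H'_def H_def Q_def using Wne
      by (intro continuous_intros zic i) (auto simp: W_def intro!: continuous_intros zic i)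
    show "\<bar>H \<theta> v x\<bar> \<le> max C (2 * \<beta> * D * C) * exp (c * (\<Sum>i\<in>I. \<bar>x i\<bar>))" for x
      using order.trans[OF HC[OF v, of \<theta> x] mult_right_mono[OF max.cobounded1 exp_ge_zero]] H0(1)[of \<theta> v x]
      unfolding L_def by simp
    show "\<bar>H' \<theta> v i x\<bar> \<le> max C (2 * \<beta> * D * C) * exp (c * (\<Sum>i\<in>I. \<bar>x i\<bar>))" for x
      using order.trans[OF H'C[OF v i, of \<theta> x] mult_right_mono[OF max.cobounded2 exp_ge_zero]]
      unfolding L_def .
  qed auto

  have iW: "integrable M (\<lambda>x. W \<theta> x powr p)" for \<theta>
    using WC by (intro integrable_exp_bound[where C=C and c=c]) (auto simp: L_def)
  have iH: "integrable M (H \<theta> v)" if "v \<in> S" for \<theta> v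
    using HC[OF that] H0 by (intro integrable_exp_bound[where C=C and c=c]) (auto simp: L_def)
  have ixH: "integrable M (\<lambda>x. x i * H \<theta> v x)" if "v \<in> S" "i \<in> I" for \<theta> v i
    using HC[OF that(1)] H0 that(2)
    by (intro integrable_exp_bound[where C=C and c="c + 1"] abs_coordinate_mult_exp_bound) (auto simp: L_def)
  have iH': "integrable M (H' \<theta> v i)" if "v \<in> S" "i \<in> I" for \<theta> v i
    using H'C[OF that] by (intro integrable_exp_bound[where C="2 * \<beta> * D * C" and c=c]) (auto simp: L_def)

  define f' where "f' \<theta> x = t * (\<Sum>v\<in>S. H \<theta> v x * z' \<theta> v x)" for \<theta> x
  define \<phi> where "\<phi> \<theta> = (\<integral>x. W \<theta> x powr p \<partial>M)" for \<theta>
  have d\<phi>: "(\<phi> has_real_derivative (\<integral>x. f' \<theta> x \<partial>M)) (at \<theta>)" for \<theta>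
    unfolding \<phi>_def
  proof (rule has_real_derivative_lebesgue_integral[OF iW])
    show "f' \<theta> \<in> borel_measurable M" unfolding f'_def by measurable
    show "((\<lambda>\<theta>. W \<theta> x powr p) has_real_derivative f' \<theta> x) (at \<theta>)" for \<theta> x
    proof -
      have "((\<lambda>\<theta>. z \<theta> v x) has_real_derivative z' \<theta> v x) (at \<theta>)" for v
        unfolding z_def z'_def m_def m'_def by (auto intro!: derivative_eq_intros sum.cong simp: algebra_simps)
      then have "((\<lambda>\<theta>. W \<theta> x) has_real_derivative (\<Sum>v\<in>S. exp (\<beta> * z \<theta> v x) * (\<beta> * z' \<theta> v x))) (at \<theta>)"
        unfolding W_def by (auto intro!: derivative_eq_intros simp: mult_ac)
      then have "((\<lambda>\<theta>. W \<theta> x powr p) has_real_derivative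
          p * W \<theta> x powr (p - 1) * (\<Sum>v\<in>S. exp (\<beta> * z \<theta> v x) * (\<beta> * z' \<theta> v x))) (at \<theta>)"
        using DERIV_fun_powr[of _ _ \<theta> p] W0[of \<theta> x] by fastforce
      also have "p * W \<theta> x powr (p - 1) * (\<Sum>v\<in>S. exp (\<beta> * z \<theta> v x) * (\<beta> * z' \<theta> v x)) = f' \<theta> x"
        unfolding f'_def H_def p(3)[symmetric] by (simp add: sum_distrib_left mult_ac)
      finally show ?thesis .
    qed
    show "\<bar>f' \<theta> x\<bar> \<le> t * (\<Sum>v\<in>S. C * D * exp ((c + 1) * L x))" for \<theta> x
    proof -
      have "\<bar>H \<theta> v x * z' \<theta> v x\<bar> \<le> C * D * exp ((c + 1) * L x)" if "v \<in> S" for v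
      proof -
        have "\<bar>z' \<theta> v x\<bar> \<le> D * L x" unfolding z'_def using mD that by (intro zD) auto
        also have "\<dots> \<le> D * exp (L x)"
          using D0 exp_ge_add_one_self[of "L x"] by (intro mult_left_mono) linarith+
        finally have "\<bar>H \<theta> v x\<bar> * \<bar>z' \<theta> v x\<bar> \<le> (C * exp (c * L x)) * (D * exp (L x))"
          using HC[OF that, of \<theta> x] H0(1)[of \<theta> v x] by (intro mult_mono) auto
        then show ?thesis by (simp add: abs_mult exp_add algebra_simps)
      qed
      then have "\<bar>\<Sum>v\<in>S. H \<theta> v x * z' \<theta> v x\<bar> \<le> (\<Sum>v\<in>S. C * D * exp ((c + 1) * L x))"
        by (intro order.trans[OF sum_abs] sum_mono) auto
      then show ?thesis unfolding f'_def abs_mult using t by simp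
    qed
    show "integrable M (\<lambda>x. t * (\<Sum>v\<in>S. C * D * exp ((c + 1) * L x)))"
      unfolding L_def by (intro integrable_mult_right Bochner_Integration.integrable_sum integrable_exp_l1)
  qed
  \<comment> \<open>The covariance of \<open>z' \<theta> v\<close> with \<open>z \<theta> w\<close>;
    the mixed terms vanish by orthogonality of the two processes.\<close>
  have cov: "(\<Sum>i\<in>I. m' \<theta> v i * (s i)\<^sup>2 * m \<theta> w i) = sin \<theta> * cos \<theta> * \<kappa> v w" if "v \<in> S" "w \<in> S" for \<theta> v w
  proof -
    have "(\<Sum>i\<in>I. m' \<theta> v i * (s i)\<^sup>2 * m \<theta> w i) =
      sin \<theta> * cos \<theta> * \<kappa> v w + (cos \<theta>)\<^sup>2 * (\<Sum>i\<in>I. (s i)\<^sup>2 * (a w i * b v i))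
        - (sin \<theta>)\<^sup>2 * (\<Sum>i\<in>I. (s i)\<^sup>2 * (a v i * b w i))"
      unfolding m_def m'_def \<kappa>_def
      by (simp add: sum_distrib_left sum_subtractf sum.distrib algebra_simps power2_eq_square)
    then show ?thesis using orth that by simp
  qed
  \<comment> \<open>On the quarter turn \<open>sin \<theta> * cos \<theta>\<close> is nonnegative,
    so the bound on the gap keeps its direction.\<close>
  have growth: "(\<integral>x. f' \<theta> x \<partial>M) \<ge> sin \<theta> * cos \<theta> * K * t\<^sup>2 * \<phi> \<theta>" if \<theta>: "0 \<le> \<theta>" "\<theta> \<le> pi / 2" for \<theta>
  proof -
    have sc: "sin \<theta> * cos \<theta> \<ge> 0" using \<theta> by (intro mult_nonneg_nonneg sin_ge_zero cos_ge_zero) auto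
    have point: "(\<Sum>i\<in>I. m' \<theta> v i * ((s i)\<^sup>2 * H' \<theta> v i x)) \<ge> t * (sin \<theta> * cos \<theta> * K) * H \<theta> v x"
      if v: "v \<in> S" for v x
    proof -
      have "(\<Sum>i\<in>I. m' \<theta> v i * ((s i)\<^sup>2 * H' \<theta> v i x)) =
        \<beta> * ((\<Sum>i\<in>I. m' \<theta> v i * (s i)\<^sup>2 * m \<theta> v i) * H \<theta> v x
          - (1 - p) * (\<Sum>w\<in>S. (\<Sum>i\<in>I. m' \<theta> v i * (s i)\<^sup>2 * m \<theta> w i) * Q \<theta> v w x))"
      proof -
        have "(\<Sum>i\<in>I. m' \<theta> v i * ((s i)\<^sup>2 * H' \<theta> v i x)) =
          \<beta> * ((\<Sum>i\<in>I. m' \<theta> v i * (s i)\<^sup>2 * m \<theta> v i) * H \<theta> v x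
            - (1 - p) * (\<Sum>i\<in>I. \<Sum>w\<in>S. m' \<theta> v i * (s i)\<^sup>2 * m \<theta> w i * Q \<theta> v w x))"
          unfolding H'_def
          by (simp add: sum_distrib_left sum_distrib_right sum_subtractf sum.distrib algebra_simps)
        also have "(\<Sum>i\<in>I. \<Sum>w\<in>S. m' \<theta> v i * (s i)\<^sup>2 * m \<theta> w i * Q \<theta> v w x) =
          (\<Sum>w\<in>S. (\<Sum>i\<in>I. m' \<theta> v i * (s i)\<^sup>2 * m \<theta> w i) * Q \<theta> v w x)"
          unfolding sum_distrib_right by (rule sum.swap)
        finally show ?thesis .
      qed
      also have "\<dots> = \<beta> * (sin \<theta> * cos \<theta>) * (\<kappa> v v * H \<theta> v x - (1 - p) * (\<Sum>w\<in>S. \<kappa> v w * Q \<theta> v w x))"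
      proof -
        have "(\<Sum>w\<in>S. (\<Sum>i\<in>I. m' \<theta> v i * (s i)\<^sup>2 * m \<theta> w i) * Q \<theta> v w x)
            = sin \<theta> * cos \<theta> * (\<Sum>w\<in>S. \<kappa> v w * Q \<theta> v w x)"
          unfolding sum_distrib_left by (intro sum.cong refl) (simp add: cov v)
        then show ?thesis unfolding cov[OF v v] by (simp add: algebra_simps)
      qed
      \<comment> \<open>The bound \<open>\<kappa> v w \<le> K\<close> meets the coefficient
        \<open>- (1 - p)\<close>, which is nonpositive as \<open>p \<le> 1\<close>; the leading term
        needs the equality \<open>\<kappa> v v = K\<close>. After collapsing \<open>Q\<close>, the
        bracket is \<open>p * K * H\<close>.\<close>
      also have "\<dots> \<ge> \<beta> * (sin \<theta> * cos \<theta>) * (K * H \<theta> v x - (1 - p) * (\<Sum>w\<in>S. K * Q \<theta> v w x))"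
        using v \<beta> sc p H0 le diag
        by (intro mult_left_mono diff_mono sum_mono mult_right_mono) auto
      also have "\<beta> * (sin \<theta> * cos \<theta>) * (K * H \<theta> v x - (1 - p) * (\<Sum>w\<in>S. K * Q \<theta> v w x))
          = t * (sin \<theta> * cos \<theta> * K) * H \<theta> v x"
        unfolding p(3)[symmetric] by (simp add: QH flip: sum_distrib_left) (simp add: algebra_simps)
      finally show ?thesis .
    qed
    have "(\<integral>x. f' \<theta> x \<partial>M) = t * (\<Sum>v\<in>S. \<Sum>i\<in>I. m' \<theta> v i * (\<integral>x. x i * H \<theta> v x \<partial>M))"
    proof -
      have "f' \<theta> x = t * (\<Sum>v\<in>S. \<Sum>i\<in>I. m' \<theta> v i * (x i * H \<theta> v x))" for x
        unfolding f'_def z'_def by (simp add: sum_distrib_left mult_ac)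
      then show ?thesis
        using ixH by (simp add: Bochner_Integration.integral_sum)
    qed
    \<comment> \<open>Integration by parts removes the linear factor \<open>x i\<close>, which
      leaves only covariances and second derivatives.\<close>
    also have "\<dots> = t * (\<Sum>v\<in>S. \<Sum>i\<in>I. m' \<theta> v i * ((s i)\<^sup>2 * (\<integral>x. H' \<theta> v i x \<partial>M)))"
      by (simp add: ibp cong: sum.cong)
    also have "\<dots> = t * (\<Sum>v\<in>S. \<integral>x. (\<Sum>i\<in>I. m' \<theta> v i * ((s i)\<^sup>2 * H' \<theta> v i x)) \<partial>M)"
      using iH' by (simp add: Bochner_Integration.integral_sum)
    also have "\<dots> \<ge> t * (\<Sum>v\<in>S. \<integral>x. t * (sin \<theta> * cos \<theta> * K) * H \<theta> v x \<partial>M)"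
      using t iH iH' point
      by (intro mult_left_mono sum_mono integral_mono Bochner_Integration.integrable_sum integrable_mult_right) auto
    also have "t * (\<Sum>v\<in>S. \<integral>x. t * (sin \<theta> * cos \<theta> * K) * H \<theta> v x \<partial>M)
        = t * (t * (sin \<theta> * cos \<theta> * K) * (\<integral>x. (\<Sum>v\<in>S. H \<theta> v x) \<partial>M))"
      using iH by (simp add: Bochner_Integration.integral_sum sum_distrib_left)
    also have "\<dots> = sin \<theta> * cos \<theta> * K * t\<^sup>2 * \<phi> \<theta>"
      unfolding HW \<phi>_def by (simp add: power2_eq_square mult_ac)
    finally show ?thesis .
  qed
  \<comment> \<open>Integrating factor for \<open>growth\<close>: the exponent
    \<open>K * t\<^sup>2 * (sin \<theta>)\<^sup>2 / 2\<close> has derivative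
    \<open>sin \<theta> * cos \<theta> * K * t\<^sup>2\<close>. At angle 0 only \<open>a\<close>
    remains, at \<open>pi / 2\<close> only \<open>b\<close> with the factor
    \<open>exp (- (K * t\<^sup>2 / 2))\<close>.\<close>
  define \<psi> where "\<psi> \<theta> = \<phi> \<theta> * exp (- (K * t\<^sup>2 * (sin \<theta>)\<^sup>2 / 2))" for \<theta>
  have "\<psi> 0 \<le> \<psi> (pi / 2)"
  proof (rule DERIV_nonneg_imp_nondecreasing[of 0 "pi / 2" \<psi>])
    fix \<theta> :: real assume \<theta>: "0 \<le> \<theta>" "\<theta> \<le> pi / 2"
    have "(\<psi> has_real_derivative
        ((\<integral>x. f' \<theta> x \<partial>M) - sin \<theta> * cos \<theta> * K * t\<^sup>2 * \<phi> \<theta>) * exp (- (K * t\<^sup>2 * (sin \<theta>)\<^sup>2 / 2))) (at \<theta>)"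
      unfolding \<psi>_def by (auto intro!: derivative_eq_intros d\<phi> simp: algebra_simps)
    moreover have "((\<integral>x. f' \<theta> x \<partial>M) - sin \<theta> * cos \<theta> * K * t\<^sup>2 * \<phi> \<theta>) * exp (- (K * t\<^sup>2 * (sin \<theta>)\<^sup>2 / 2)) \<ge> 0"
      using growth[OF \<theta>] by simp
    ultimately show "\<exists>y. (\<psi> has_real_derivative y) (at \<theta>) \<and> 0 \<le> y"
      by blast
  qed simp
  then show ?thesis
    by (simp add: \<psi>_def \<phi>_def W_def z_def m_def p_def mult.commute)
qed

end

section \<open>Exponential moment of the norm of a standard Gaussian vector\<close>

lemma gaussian_vector_standard: "finite B \<Longrightarrow> gaussian_vector B (\<lambda>_. 1)"
  by standard auto

text \<open>Bound \<open>r |x|\<close> by \<open>q |x|\<^sup>2 / 2 + r\<^sup>2 / (2 q)\<close>, which makes the expectation a product; the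
  optimal \<open>q\<close> is \<open>1 - y\<^sup>2\<close> with \<open>1 - y\<^sup>2 = r y / sqrt k\<close>.\<close>

lemma gaussian_norm_exponential_moment:
  fixes B :: "'i set"
  assumes B: "finite B" "B \<noteq> {}" and r: "r > 0"
  defines "G \<equiv> PiM B (\<lambda>_. centered_normal 1)"
  shows "integrable G (\<lambda>x. exp (r * sqrt (\<Sum>e\<in>B. (x e)\<^sup>2)))"
    and "(\<integral>x. exp (r * sqrt (\<Sum>e\<in>B. (x e)\<^sup>2)) \<partial>G) \<le> exp (r * sqrt (card B) + r\<^sup>2 / 2)"
proof -
  interpret gaussian_vector B "\<lambda>_. 1" using B(1) by (rule gaussian_vector_standard)
  define k where "k = real (card B)"
  define \<sigma> where "\<sigma> = r / sqrt k"
  \<comment> \<open>The positive root of \<open>y\<^sup>2 + \<sigma> * y = 1\<close>, the condition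
    making the derivative in \<open>q\<close> of
    \<open>r\<^sup>2 / (2 * q) - k / 2 * ln (1 - q)\<close> vanish at
    \<open>q = 1 - y\<^sup>2\<close>.\<close>
  define y where "y = (sqrt (\<sigma>\<^sup>2 + 4) - \<sigma>) / 2"
  have k: "k > 0" using B by (simp add: k_def card_gt_0_iff)
  have \<sigma>: "\<sigma> > 0" "r = sqrt k * \<sigma>" using r k by (simp_all add: \<sigma>_def)
  have y: "0 < y" "y < 1" "1 - y\<^sup>2 = \<sigma> * y"
  proof -
    have "\<sigma> < sqrt (\<sigma>\<^sup>2 + 4)" by (rule real_less_rsqrt) simp
    then show "0 < y" by (simp add: y_def)
    have "sqrt (\<sigma>\<^sup>2 + 4) < \<sigma> + 2"
      using \<sigma> by (intro real_less_lsqrt) (auto simp: power2_eq_square algebra_simps)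
    then show "y < 1" by (simp add: y_def)
    have "(sqrt (\<sigma>\<^sup>2 + 4))\<^sup>2 = \<sigma>\<^sup>2 + 4" by (simp add: add_nonneg_nonneg)
    then show "1 - y\<^sup>2 = \<sigma> * y" by (simp add: y_def power2_eq_square field_simps)
  qed
  define q where "q = 1 - y\<^sup>2"
  have q: "0 < q" "q < 1" "sqrt (1 - q) = y" using y(1,2) by (auto simp: q_def power_less_one_iff)
  define c where "c = r\<^sup>2 / (2 * q)"
  let ?n = "\<lambda>x. sqrt (\<Sum>e\<in>B. (x e)\<^sup>2)"
  let ?g = "\<lambda>x. exp c * (\<Prod>e\<in>B. exp (q * (x e)\<^sup>2 / 2))"
  have pt: "exp (r * ?n x) \<le> ?g x" for x :: "'i \<Rightarrow> real"
  proof -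
    have sq: "(?n x)\<^sup>2 = (\<Sum>e\<in>B. (x e)\<^sup>2)" by (simp add: sum_nonneg)
    have "0 \<le> (q * ?n x - r)\<^sup>2 / (2 * q)" using q by simp
    also have "\<dots> = q * (?n x)\<^sup>2 / 2 + c - r * ?n x"
      using q by (simp add: c_def power2_eq_square field_simps)
    finally have "r * ?n x \<le> c + (\<Sum>e\<in>B. q * (x e)\<^sup>2 / 2)"
      unfolding sq by (simp add: sum_distrib_left sum_divide_distrib)
    then show ?thesis by (simp only: exp_sum[OF B(1), symmetric] exp_add[symmetric] exp_le_cancel_iff)
  qed
  note single = normal_mean_exp_square[OF q(2)]
  have ig: "integrable G ?g"
    unfolding G_def using single(1) by (intro integrable_mult_right product_integrable_prod B) auto
  show int: "integrable G (\<lambda>x. exp (r * ?n x))"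
    by (rule Bochner_Integration.integrable_bound[OF ig])
       (use pt in \<open>auto simp: G_def abs_of_nonneg prod_nonneg\<close>)
  have "(\<integral>x. exp (r * ?n x) \<partial>G) \<le> (\<integral>x. ?g x \<partial>G)"
    by (intro integral_mono int ig pt)
  also have "\<dots> = exp c * (1 / y) ^ card B"
    unfolding G_def using single
    by (subst integral_mult_right_zero, subst product_integral_prod[OF B(1)]) (auto simp: q)
  also have "\<dots> = exp (c + k * ln (1 / y))"
    using y by (simp add: exp_add k_def exp_of_nat_mult)
  also have "\<dots> \<le> exp (r * sqrt k + r\<^sup>2 / 2)"
  proof -
    have "ln (1 / y) \<le> 1 / y - 1" using y by (intro ln_le_minus_one) auto
    moreover have r2: "r\<^sup>2 = k * \<sigma>\<^sup>2" "r * sqrt k = k * \<sigma>"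
      using k \<sigma>(2) by (simp_all add: power_mult_distrib)
    have s: "\<sigma> = (1 - y\<^sup>2) / y" using y by (simp add: field_simps)
    have cc: "c = k * (\<sigma> / y) / 2"
      unfolding c_def q_def y(3) r2 using \<sigma>(1) y(1) by (simp add: field_simps power2_eq_square)
    \<comment> \<open>Divided by \<open>k\<close>, the claim involves only \<open>y\<close>, since
      \<open>\<sigma> = 1 / y - y\<close>; after the logarithm is linearized, the two sides differ
      by the square \<open>(1 - y)\<^sup>2 / 2\<close>.\<close>
    have "\<sigma> / y / 2 + (1 / y - 1) \<le> \<sigma> + \<sigma>\<^sup>2 / 2"
    proof -
      have "\<sigma> + \<sigma>\<^sup>2 / 2 - \<sigma> / y / 2 - (1 / y - 1) = (1 - y)\<^sup>2 / 2"
        unfolding s using y(1) by (simp add: field_simps power2_eq_square)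
      then show ?thesis using zero_le_power2[of "1 - y"] by linarith
    qed
    ultimately have "\<sigma> / y / 2 + ln (1 / y) \<le> \<sigma> + \<sigma>\<^sup>2 / 2" by linarith
    then have "k * (\<sigma> / y / 2 + ln (1 / y)) \<le> k * (\<sigma> + \<sigma>\<^sup>2 / 2)" using k by (intro mult_left_mono) auto
    then show ?thesis unfolding cc r2 by (simp add: algebra_simps)
  qed
  finally show "(\<integral>x. exp (r * ?n x) \<partial>G) \<le> exp (r * sqrt (card B) + r\<^sup>2 / 2)" by (simp add: k_def)
qed

section \<open>Quadratic forms of the symmetric Gaussian matrix\<close>

definition pairs :: "'n set set" where "pairs = {p. \<exists>i j. p = {i, j}}"

text \<open>The coefficient of the entry \<open>g p\<close> in \<open>v^T G v\<close>: a square on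
  the diagonal and, because both orders are counted, twice the product off it.\<close>

definition rank_one_coeff :: "real^'n \<Rightarrow> 'n set \<Rightarrow> real" where
  "rank_one_coeff v p = (\<Sum>(i, j) | {i, j} = p. v $ i * v $ j)"

text \<open>Ordered index pairs are grouped by their unordered pair. \<open>g\<close> is arbitrary
  because the covariance computation puts a deterministic weight in its place.\<close>

lemma quadratic_form_pairs:
  fixes v :: "real^'n"
  shows "(\<Sum>i\<in>UNIV. \<Sum>j\<in>UNIV. v $ i * v $ j * g {i, j}) = (\<Sum>p\<in>pairs. rank_one_coeff v p * g p)"
proof -
  have "(\<Sum>i\<in>UNIV. \<Sum>j\<in>UNIV. v $ i * v $ j * g {i, j}) = (\<Sum>(i, j)\<in>UNIV. v $ i * v $ j * g {i, j})"
    by (simp add: sum.cartesian_product)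
  also have "\<dots> = (\<Sum>p\<in>pairs. \<Sum>x\<in>{x \<in> UNIV. (\<lambda>(i, j). {i, j}) x = p}. (\<lambda>(i, j). v $ i * v $ j * g {i, j}) x)"
    by (rule sum.group[symmetric]) (auto simp: pairs_def)
  also have "\<dots> = (\<Sum>p\<in>pairs. rank_one_coeff v p * g p)"
    unfolding rank_one_coeff_def sum_distrib_right by (intro sum.cong) auto
  finally show ?thesis .
qed

lemma sym_gauss_var_pos: "sym_gauss_var p > 0"
  by (simp add: sym_gauss_var_def)

text \<open>The variance 1/2 off the diagonal cancels the multiplicity 2 of an off-diagonal
  pair.\<close>

lemma var_mult_rank_one_coeff: "sym_gauss_var {i, j} * rank_one_coeff w {i, j} = w $ i * w $ j"
proof (cases "i = j")
  case True
  have "{(a, b). {a, b} = {j}} = {(j, j)}" by auto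
  then show ?thesis using True by (simp add: rank_one_coeff_def sym_gauss_var_def)
next
  case False
  have "{(a, b). {a, b} = {i, j}} = {(i, j), (j, i)}" by (auto simp: doubleton_eq_iff)
  then show ?thesis using False by (simp add: rank_one_coeff_def sym_gauss_var_def)
qed

text \<open>This is the covariance of \<open>v^T G v\<close> and \<open>w^T G w\<close>, that is,
  the trace inner product of \<open>v v^T\<close> and \<open>w w^T\<close>.\<close>

lemma rank_one_coeff_inner:
  fixes v w :: "real^'n"
  shows "(\<Sum>p\<in>pairs. sym_gauss_var p * (rank_one_coeff v p * rank_one_coeff w p)) = (v \<bullet> w)\<^sup>2"
proof -
  have "(\<Sum>p\<in>pairs. sym_gauss_var p * (rank_one_coeff v p * rank_one_coeff w p))
      = (\<Sum>i\<in>UNIV. \<Sum>j\<in>UNIV. v $ i * v $ j * (sym_gauss_var {i, j} * rank_one_coeff w {i, j}))"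
    unfolding quadratic_form_pairs[where g = "\<lambda>p. sym_gauss_var p * rank_one_coeff w p"]
    by (simp add: mult_ac)
  also have "\<dots> = (\<Sum>i\<in>UNIV. v $ i * w $ i) * (\<Sum>j\<in>UNIV. v $ j * w $ j)"
    unfolding var_mult_rank_one_coeff sum_product by (simp add: mult_ac)
  finally show ?thesis by (simp add: inner_vec_def power2_eq_square)
qed

lemma orthonormal_parseval:
  fixes B :: "'a::euclidean_space set"
  assumes "pairwise orthogonal B" "\<And>x. x \<in> B \<Longrightarrow> norm x = 1" "finite B" "v \<in> span B"
  shows "(\<Sum>e\<in>B. (v \<bullet> e) * (w \<bullet> e)) = v \<bullet> w"
proof -
  have "v \<bullet> w = (\<Sum>e\<in>B. (v \<bullet> e) *\<^sub>R e) \<bullet> w"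
    using orthonormal_basis_expand[OF assms(1,2,4,3)] by simp
  then show ?thesis by (simp add: inner_sum_left inner_commute[of w])
qed

text \<open>Marginalization: the comparison lives on a product over two blocks of coordinates, and
  each resulting integral depends on a single block.\<close>

lemma
  fixes F :: "('j \<Rightarrow> 'b) \<Rightarrow> real"
  assumes M: "\<And>i. i \<in> I \<Longrightarrow> prob_space (M i)" and f: "inj_on f J" "f \<in> J \<rightarrow> I"
    and F: "F \<in> borel_measurable (\<Pi>\<^sub>M j\<in>J. M (f j))"
  shows integral_PiM_reindex:
      "(\<integral>x. F x \<partial>(\<Pi>\<^sub>M j\<in>J. M (f j))) = (\<integral>x. F (\<lambda>j\<in>J. x (f j)) \<partial>PiM I M)"
    and integrable_PiM_reindex:
      "integrable (\<Pi>\<^sub>M j\<in>J. M (f j)) F \<Longrightarrow> integrable (PiM I M) (\<lambda>x. F (\<lambda>j\<in>J. x (f j)))"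
proof -
  let ?r = "\<lambda>x. \<lambda>j\<in>J. x (f j)"
  have r: "?r \<in> measurable (PiM I M) (\<Pi>\<^sub>M j\<in>J. M (f j))"
    using f(2) by (intro measurable_restrict measurable_component_singleton) auto
  have d: "distr (PiM I M) (\<Pi>\<^sub>M j\<in>J. M (f j)) ?r = (\<Pi>\<^sub>M j\<in>J. M (f j))"
    by (rule distr_PiM_reindex[OF M f])
  show "(\<integral>x. F x \<partial>(\<Pi>\<^sub>M j\<in>J. M (f j))) = (\<integral>x. F (?r x) \<partial>PiM I M)"
    using integral_distr[OF r F] unfolding d .
  show "integrable (PiM I M) (\<lambda>x. F (?r x))" if "integrable (\<Pi>\<^sub>M j\<in>J. M (f j)) F"
    using integrable_distr_eq[OF r F] that unfolding d by blast
qed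

text \<open>The law of the independent entries before they are assembled into a matrix; estimates
  are made here, where the product structure is visible.\<close>

definition pair_gauss :: "('n set \<Rightarrow> real) measure" where
  "pair_gauss = PiM pairs (\<lambda>p. centered_normal (sqrt (sym_gauss_var p)))"

lemma gaussian_vector_pairs:
  "gaussian_vector (pairs :: 'n::finite set set) (\<lambda>p. sqrt (sym_gauss_var p))"
  by standard (auto simp: sym_gauss_var_pos)

definition pair_form :: "('n set \<Rightarrow> real) \<Rightarrow> real^'n \<Rightarrow> real" where
  "pair_form g v = (\<Sum>i\<in>UNIV. \<Sum>j\<in>UNIV. v $ i * v $ j * g {i, j})"

text \<open>The process \<open>v\<^sup>T G v\<close> on the unit sphere of \<open>V\<close> has covariance \<open>(v \<bullet> w)\<^sup>2\<close>; it is compared with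
  \<open>sqrt 2 (v \<bullet> y)\<close>, \<open>y\<close> standard Gaussian in \<open>V\<close>. The gap is \<open>2 (v \<bullet> w) - (v \<bullet> w)\<^sup>2 = 1 - (1 - v \<bullet> w)\<^sup>2\<close>.\<close>

lemma powr_sum_exp_pair_form_le:
  fixes V :: "(real^'n) set"
  assumes V: "subspace V" "dim V = k" "k \<ge> 1"
    and S: "finite S" "S \<noteq> {}" "S \<subseteq> V" "\<And>v. v \<in> S \<Longrightarrow> norm v = 1"
    and t: "0 < t" "t \<le> \<beta>"
  shows "(\<integral>g. (\<Sum>v\<in>S. exp (\<beta> * pair_form g v)) powr (t / \<beta>) \<partial>pair_gauss)
    \<le> real (card S) powr (t / \<beta>) * exp (t * sqrt (2 * real k) + t\<^sup>2 / 2)"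
proof -
  obtain B where B: "B \<subseteq> V" "pairwise orthogonal B" "\<And>x. x \<in> B \<Longrightarrow> norm x = 1"
      "independent B" "card B = k" "span B = V"
    using orthonormal_basis_subspace[OF V(1)] V(2) by metis
  have finB: "finite B" "B \<noteq> {}" using B(5) V(3) by (auto simp: card_ge_0_finite)
  have parseval: "(\<Sum>e\<in>B. (v \<bullet> e) * (w \<bullet> e)) = v \<bullet> w" if "v \<in> S" for v w
    using that S(3) B by (intro orthonormal_parseval finB) auto
  \<comment> \<open>The disjoint sum carries both processes independently: \<open>a\<close> is
    supported on the entries of \<open>G\<close>, \<open>b\<close> on the coordinates of
    \<open>y\<close> in the orthonormal basis \<open>B\<close>, so orthogonality is
    immediate.\<close>
  define I where "I = (pairs :: 'n set set) <+> B"
  define s where "s = case_sum (\<lambda>p :: 'n set. sqrt (sym_gauss_var p)) (\<lambda>_ :: real^'n. 1)"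
  define a where "a v = case_sum (rank_one_coeff v) (\<lambda>_ :: real^'n. 0)" for v :: "real^'n"
  define b where "b v = case_sum (\<lambda>_ :: 'n set. 0) (\<lambda>e. sqrt 2 * (v \<bullet> e))" for v :: "real^'n"
  interpret gaussian_vector I s
    by standard (auto simp: I_def finB s_def sym_gauss_var_pos split: sum.split)
  define nB where "nB x = sqrt (\<Sum>e\<in>B. (x e)\<^sup>2)" for x :: "real^'n \<Rightarrow> real"
  have sumI: "(\<Sum>i\<in>I. h i) = (\<Sum>p\<in>pairs. h (Inl p)) + (\<Sum>e\<in>B. h (Inr e))" for h :: "'n set + real^'n \<Rightarrow> real"
    unfolding I_def by (subst sum.Plus) (auto simp: finB comp_def)
  have NL: "(\<lambda>p. N (Inl p)) = (\<lambda>p. centered_normal (sqrt (sym_gauss_var p)))"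
    and NR: "(\<lambda>e. N (Inr e)) = (\<lambda>_. centered_normal 1)"
    by (auto simp: s_def)
  have ax: "(\<Sum>i\<in>I. a v i * x i) = pair_form (\<lambda>p\<in>pairs. x (Inl p)) v" for v x
    unfolding sumI pair_form_def quadratic_form_pairs by (simp add: a_def)
  \<comment> \<open>Cauchy-Schwarz for a unit vector; the bound does not depend on \<open>v\<close>,
    so all vectors of \<open>S\<close> share it.\<close>
  have bx: "(\<Sum>i\<in>I. b v i * x i) \<le> sqrt 2 * nB (\<lambda>e\<in>B. x (Inr e))" if "v \<in> S" for v x
  proof -
    have "(\<Sum>e\<in>B. (v \<bullet> e) * x (Inr e)) \<le> (\<Sum>e\<in>B. \<bar>v \<bullet> e\<bar> * \<bar>x (Inr e)\<bar>)"
      by (intro sum_mono) (simp add: abs_mult[symmetric])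
    also have "\<dots> \<le> L2_set (\<lambda>e. v \<bullet> e) B * L2_set (\<lambda>e. x (Inr e)) B"
      by (rule L2_set_mult_ineq)
    also have "\<dots> = nB (\<lambda>e\<in>B. x (Inr e))"
      using parseval[OF that, of v] S(4)[OF that]
      by (simp add: L2_set_def nB_def power2_eq_square norm_eq_sqrt_inner)
    finally have "sqrt 2 * (\<Sum>e\<in>B. (v \<bullet> e) * x (Inr e)) \<le> sqrt 2 * nB (\<lambda>e\<in>B. x (Inr e))"
      by simp
    then show ?thesis unfolding sumI by (simp add: b_def sum_distrib_left mult_ac)
  qed
  have cov: "(\<Sum>i\<in>I. (s i)\<^sup>2 * (b v i * b w i)) - (\<Sum>i\<in>I. (s i)\<^sup>2 * (a v i * a w i)) = 2 * (v \<bullet> w) - (v \<bullet> w)\<^sup>2"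
    if "v \<in> S" for v w
  proof -
    have "(\<Sum>e\<in>B. sqrt 2 * (v \<bullet> e) * (sqrt 2 * (w \<bullet> e))) = (\<Sum>e\<in>B. 2 * ((v \<bullet> e) * (w \<bullet> e)))"
      by (intro sum.cong refl) (simp add: mult_ac)
    then have "(\<Sum>e\<in>B. sqrt 2 * (v \<bullet> e) * (sqrt 2 * (w \<bullet> e))) = 2 * (v \<bullet> w)"
      using parseval[OF that] by (simp flip: sum_distrib_left)
    then show ?thesis
      unfolding sumI using rank_one_coeff_inner[of v w]
      by (simp add: s_def a_def b_def sym_gauss_var_pos less_imp_le)
  qed
  have main: "(\<integral>x. (\<Sum>v\<in>S. exp (\<beta> * (\<Sum>i\<in>I. a v i * x i))) powr (t / \<beta>) \<partial>M)
    \<le> exp (- (1 * t\<^sup>2 / 2)) * (\<integral>x. (\<Sum>v\<in>S. exp (\<beta> * (\<Sum>i\<in>I. b v i * x i))) powr (t / \<beta>) \<partial>M)"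
  proof (rule exponential_comparison[OF S(1,2) t])
    show "(\<Sum>i\<in>I. (s i)\<^sup>2 * (a v i * b w i)) = 0" for v w
      unfolding sumI by (simp add: a_def b_def)
    show "(\<Sum>i\<in>I. (s i)\<^sup>2 * (b v i * b w i)) - (\<Sum>i\<in>I. (s i)\<^sup>2 * (a v i * a w i)) \<le> 1"
      if "v \<in> S" "w \<in> S" for v w
      unfolding cov[OF that(1)] using zero_le_power2[of "1 - v \<bullet> w"] by (simp add: power2_eq_square algebra_simps)
    show "(\<Sum>i\<in>I. (s i)\<^sup>2 * (b v i * b v i)) - (\<Sum>i\<in>I. (s i)\<^sup>2 * (a v i * a v i)) = 1"
      if "v \<in> S" for v
      unfolding cov[OF that] using S(4)[OF that] by (simp add: dot_square_norm)
  qed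
  let ?C = "real (card S) powr (t / \<beta>)"
  \<comment> \<open>The moment bound at \<open>r = t * sqrt 2\<close>, where
    \<open>r\<^sup>2 / 2 = t\<^sup>2\<close>; the comparison with \<open>K = 1\<close> later removes
    half of this.\<close>
  have nB_moment: "integrable (PiM B (\<lambda>e. N (Inr e))) (\<lambda>x. exp (t * sqrt 2 * nB x))"
      "(\<integral>x. exp (t * sqrt 2 * nB x) \<partial>PiM B (\<lambda>e. N (Inr e))) \<le> exp (t * sqrt (2 * k) + t\<^sup>2)"
    using gaussian_norm_exponential_moment[OF finB, of "t * sqrt 2"] t B(5)
    unfolding NR nB_def by (auto simp: real_sqrt_mult power_mult_distrib mult_ac)
  have R: "inj_on Inr B" "Inr \<in> B \<rightarrow> I" and L: "inj_on Inl pairs" "Inl \<in> pairs \<rightarrow> I"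
    by (auto simp: I_def)
  have psN: "prob_space (N i)" for i
    by (rule N.prob_space_axioms)
  have mR: "(\<lambda>x. exp (t * sqrt 2 * nB x)) \<in> borel_measurable (PiM B (\<lambda>e. N (Inr e)))"
    using nB_moment(1) by (rule borel_measurable_integrable)
  have mL: "(\<lambda>g. (\<Sum>v\<in>S. exp (\<beta> * pair_form g v)) powr (t / \<beta>)) \<in> borel_measurable (PiM pairs (\<lambda>p. N (Inl p)))"
    unfolding pair_form_def quadratic_form_pairs by measurable
  have "(\<integral>x. (\<Sum>v\<in>S. exp (\<beta> * (\<Sum>i\<in>I. b v i * x i))) powr (t / \<beta>) \<partial>M)
      \<le> (\<integral>x. ?C * exp (t * sqrt 2 * nB (\<lambda>e\<in>B. x (Inr e))) \<partial>M)"
  proof (rule integral_mono')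
    show "integrable M (\<lambda>x. ?C * exp (t * sqrt 2 * nB (\<lambda>e\<in>B. x (Inr e))))"
      by (intro integrable_mult_right integrable_PiM_reindex[OF psN R mR] nB_moment)
    fix x
    have "(\<Sum>v\<in>S. exp (\<beta> * (\<Sum>i\<in>I. b v i * x i))) \<le> (\<Sum>v\<in>S. exp (\<beta> * (sqrt 2 * nB (\<lambda>e\<in>B. x (Inr e)))))"
      using t bx by (intro sum_mono) (auto intro!: mult_left_mono)
    then have "(\<Sum>v\<in>S. exp (\<beta> * (\<Sum>i\<in>I. b v i * x i))) powr (t / \<beta>)
        \<le> (card S * exp (\<beta> * (sqrt 2 * nB (\<lambda>e\<in>B. x (Inr e))))) powr (t / \<beta>)"
      using t by (intro powr_mono2) (auto intro!: sum_nonneg)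
    also have "\<dots> = ?C * exp (t * sqrt 2 * nB (\<lambda>e\<in>B. x (Inr e)))"
      using t by (simp add: powr_mult exp_powr_real mult_ac)
    finally show "(\<Sum>v\<in>S. exp (\<beta> * (\<Sum>i\<in>I. b v i * x i))) powr (t / \<beta>)
        \<le> ?C * exp (t * sqrt 2 * nB (\<lambda>e\<in>B. x (Inr e)))" .
  qed auto
  also have "\<dots> = ?C * (\<integral>x. exp (t * sqrt 2 * nB x) \<partial>PiM B (\<lambda>e. N (Inr e)))"
    using integral_PiM_reindex[OF psN R mR] by simp
  also have "\<dots> \<le> ?C * exp (t * sqrt (2 * k) + t\<^sup>2)"
    using nB_moment(2) by (rule mult_left_mono) simp
  finally have "(\<integral>x. (\<Sum>v\<in>S. exp (\<beta> * (\<Sum>i\<in>I. a v i * x i))) powr (t / \<beta>) \<partial>M)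
      \<le> exp (- (1 * t\<^sup>2 / 2)) * (?C * exp (t * sqrt (2 * k) + t\<^sup>2))"
    using main by (meson order.trans mult_left_mono exp_ge_zero)
  also have "\<dots> = ?C * exp (t * sqrt (2 * k) + t\<^sup>2 / 2)"
    by (simp add: exp_add[symmetric] mult.left_commute)
  finally show ?thesis
    unfolding ax integral_PiM_reindex[OF psN L mL, symmetric] pair_gauss_def NL by simp
qed

section \<open>Measurability and integrability under \<open>pair_gauss\<close>\<close>

lemma sets_pair_gauss [measurable_cong]:
  "sets (pair_gauss :: ('n::finite set \<Rightarrow> real) measure) = sets (PiM pairs (\<lambda>_. borel))"
  unfolding pair_gauss_def by (intro sets_PiM_cong) auto

lemma mem_pairs [simp]: "{i, j} \<in> pairs" by (auto simp: pairs_def)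

lemma pair_form_measurable [measurable]:
  "(\<lambda>g. pair_form g v) \<in> borel_measurable pair_gauss"
  unfolding pair_form_def by measurable

context gaussian_vector
begin

lemma integrable_coordinate: "i \<in> I \<Longrightarrow> integrable M (\<lambda>x. x i)"
  using abs_coordinate_mult_exp_bound[of i 1 1 0]
  by (intro integrable_exp_bound[where C = 1 and c = 1]) auto

text \<open>Integration by parts against the constant 1, whose derivative is 0.\<close>

lemma expectation_coordinate: "i \<in> I \<Longrightarrow> (\<integral>x. x i \<partial>M) = 0"
  using integration_by_parts[of i "\<lambda>_. 1" "\<lambda>_. 0" 1 0] by simp

end

lemma prob_space_pair_gauss: "prob_space (pair_gauss :: ('n::finite set \<Rightarrow> real) measure)"
proof -
  interpret gaussian_vector "pairs :: 'n set set" "\<lambda>p. sqrt (sym_gauss_var p)"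
    by (rule gaussian_vector_pairs)
  show ?thesis unfolding pair_gauss_def by (rule prob_space_axioms)
qed

lemma integrable_pair_entry: "integrable pair_gauss (\<lambda>g. g {i, j :: 'n::finite})"
proof -
  interpret gaussian_vector "pairs :: 'n set set" "\<lambda>p. sqrt (sym_gauss_var p)"
    by (rule gaussian_vector_pairs)
  show ?thesis unfolding pair_gauss_def by (rule integrable_coordinate) simp
qed

lemma expectation_pair_entry: "(\<integral>g. g {i, j :: 'n::finite} \<partial>pair_gauss) = 0"
proof -
  interpret gaussian_vector "pairs :: 'n set set" "\<lambda>p. sqrt (sym_gauss_var p)"
    by (rule gaussian_vector_pairs)
  show ?thesis unfolding pair_gauss_def by (rule expectation_coordinate) simp
qed

lemma integrable_pair_form: "integrable pair_gauss (\<lambda>g. pair_form g v)"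
  unfolding pair_form_def by (intro Bochner_Integration.integrable_sum integrable_mult_right integrable_pair_entry)

lemma integrable_exp_pair_form: "integrable pair_gauss (\<lambda>g. exp (t * pair_form g (v :: real^'n)))"
proof -
  interpret gaussian_vector "pairs :: 'n set set" "\<lambda>p. sqrt (sym_gauss_var p)"
    by (rule gaussian_vector_pairs)
  define D where "D = (\<Sum>p\<in>pairs. \<bar>rank_one_coeff v p\<bar>)"
  have "\<bar>pair_form g v\<bar> \<le> D * (\<Sum>p\<in>pairs. \<bar>g p\<bar>)" for g
  proof -
    have "\<bar>pair_form g v\<bar> \<le> (\<Sum>p\<in>pairs. D * \<bar>g p\<bar>)"
      unfolding pair_form_def quadratic_form_pairs
    proof (intro order.trans[OF sum_abs] sum_mono)
      fix p :: "'n set" assume "p \<in> pairs"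
      then have "\<bar>rank_one_coeff v p\<bar> \<le> D"
        unfolding D_def by (intro member_le_sum) auto
      then show "\<bar>rank_one_coeff v p * g p\<bar> \<le> D * \<bar>g p\<bar>"
        by (simp add: abs_mult mult_right_mono)
    qed
    then show ?thesis by (simp add: sum_distrib_left)
  qed
  then have "\<bar>t\<bar> * \<bar>pair_form g v\<bar> \<le> \<bar>t\<bar> * (D * (\<Sum>p\<in>pairs. \<bar>g p\<bar>))" for g
    by (intro mult_left_mono) auto
  moreover have "t * pair_form g v \<le> \<bar>t\<bar> * \<bar>pair_form g v\<bar>" for g
    unfolding abs_mult[symmetric] by (rule abs_ge_self)
  ultimately have bound: "t * pair_form g v \<le> \<bar>t\<bar> * D * (\<Sum>p\<in>pairs. \<bar>g p\<bar>)" for g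
    unfolding mult.assoc by (rule order.trans[rotated])
  have meas: "(\<lambda>g. exp (t * pair_form g v)) \<in> borel_measurable pair_gauss"
    by measurable
  show ?thesis
    unfolding pair_gauss_def
    by (rule integrable_exp_bound[OF meas[unfolded pair_gauss_def], where C = 1 and c = "\<bar>t\<bar> * D"])
       (simp add: bound)
qed

section \<open>Maxima over finite sets of unit vectors\<close>

lemma pair_form_Max_measurable [measurable]:
  "finite S \<Longrightarrow> (\<lambda>g. Max (pair_form g ` S)) \<in> borel_measurable pair_gauss"
  by (rule borel_measurable_Max) measurable

lemma exp_Max_pair_form_le:
  assumes "finite S" "S \<noteq> {}"
  shows "exp (t * Max (pair_form g ` S)) \<le> (\<Sum>v\<in>S. exp (t * pair_form g v))"
proof -
  have "Max (pair_form g ` S) \<in> pair_form g ` S" using assms by (intro Max_in) auto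
  then obtain v where "v \<in> S" "Max (pair_form g ` S) = pair_form g v" by auto
  then show ?thesis
    using assms by (auto intro: member_le_sum[of v S "\<lambda>v. exp (t * pair_form g v)"])
qed

lemma integrable_exp_Max_pair_form:
  assumes "finite S" "S \<noteq> {}"
  shows "integrable pair_gauss (\<lambda>g. exp (t * Max (pair_form g ` S)))"
proof (rule Bochner_Integration.integrable_bound)
  show "integrable pair_gauss (\<lambda>g. \<Sum>v\<in>S. exp (t * pair_form g v))"
    by (intro Bochner_Integration.integrable_sum integrable_exp_pair_form)
  show "AE g in pair_gauss. norm (exp (t * Max (pair_form g ` S))) \<le> norm (\<Sum>v\<in>S. exp (t * pair_form g v))"
    using exp_Max_pair_form_le[OF assms] by (intro AE_I2) (simp add: sum_nonneg)
qed (use assms in measurable)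

text \<open>Let \<open>\<beta> \<rightarrow> \<infinity>\<close> in the previous estimate.\<close>

lemma expectation_exp_Max_pair_form_le:
  fixes V :: "(real^'n) set"
  assumes V: "subspace V" "dim V = k" "k \<ge> 1"
    and S: "finite S" "S \<noteq> {}" "S \<subseteq> V" "\<And>v. v \<in> S \<Longrightarrow> norm v = 1"
    and t: "0 < t"
  shows "(\<integral>g. exp (t * Max (pair_form g ` S)) \<partial>pair_gauss) \<le> exp (t * sqrt (2 * real k) + t\<^sup>2 / 2)"
proof -
  let ?E = "exp (t * sqrt (2 * real k) + t\<^sup>2 / 2)"
  let ?c = "\<lambda>n. real (card S) powr (1 / real n)"
  have le: "(\<integral>g. exp (t * Max (pair_form g ` S)) \<partial>pair_gauss) \<le> ?c n * ?E" if n: "n \<ge> 1" for n :: nat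
  proof -
    \<comment> \<open>Makes the outer power \<open>1 / n\<close>, so that the cardinality factor
      tends to 1.\<close>
    define \<beta> where "\<beta> = t * real n"
    have \<beta>: "t \<le> \<beta>" "t / \<beta> = 1 / n" "\<beta> > 0" using t n by (auto simp: \<beta>_def)
    let ?W = "\<lambda>g. \<Sum>v\<in>S. exp (\<beta> * pair_form g v)"
    \<comment> \<open>Only for integrability: a power with exponent at most 1 is dominated by
      \<open>1 + y\<close>.\<close>
    have powr_le: "y powr (1 / n) \<le> 1 + y" if "y \<ge> 0" for y :: real
    proof (cases "y \<le> 1")
      case True
      then have "y powr (1 / n) \<le> 1" using that by (intro powr_le1) auto
      then show ?thesis using that by simp
    next
      case False
      then have "y powr (1 / n) \<le> y powr 1" using n by (intro powr_mono) auto
      then show ?thesis using False by simp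
    qed
    have "(\<integral>g. exp (t * Max (pair_form g ` S)) \<partial>pair_gauss) \<le> (\<integral>g. ?W g powr (t / \<beta>) \<partial>pair_gauss)"
    proof (rule integral_mono')
      interpret prob_space "pair_gauss :: ('n set \<Rightarrow> real) measure" by (rule prob_space_pair_gauss)
      have i: "integrable pair_gauss (\<lambda>g. 1 + ?W g)"
        by (intro Bochner_Integration.integrable_add Bochner_Integration.integrable_sum
              integrable_exp_pair_form integrable_const)
      show "integrable pair_gauss (\<lambda>g. ?W g powr (t / \<beta>))"
        by (rule Bochner_Integration.integrable_bound[OF i])
           (auto simp: \<beta>(2) sum_nonneg intro!: AE_I2 powr_le)
      fix g
      have "exp (t * Max (pair_form g ` S)) = exp (\<beta> * Max (pair_form g ` S)) powr (t / \<beta>)"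
        using \<beta>(3) by (simp add: exp_powr_real)
      also have "\<dots> \<le> ?W g powr (t / \<beta>)"
        using t \<beta> exp_Max_pair_form_le[OF S(1,2), of \<beta> g] by (intro powr_mono2) auto
      finally show "exp (t * Max (pair_form g ` S)) \<le> ?W g powr (t / \<beta>)" .
    qed auto
    also have "\<dots> \<le> ?c n * ?E"
      using powr_sum_exp_pair_form_le[OF V S t \<beta>(1)] by (simp add: \<beta>(2))
    finally show ?thesis .
  qed
  have "card S > 0" using S by (simp add: card_gt_0_iff)
  then have "?c \<longlonglongrightarrow> real (card S) powr 0"
    by (intro tendsto_powr tendsto_const lim_1_over_n) auto
  then have "(\<lambda>n. ?c n * ?E) \<longlonglongrightarrow> real (card S) powr 0 * ?E"
    by (intro tendsto_mult tendsto_const)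
  then have "(\<lambda>n. ?c n * ?E) \<longlonglongrightarrow> ?E" using \<open>card S > 0\<close> by simp
  then show ?thesis using le by (intro LIMSEQ_le_const) auto
qed

text \<open>Jensen's inequality is replaced by the tangent line \<open>1 + x \<le> exp x\<close> at
  \<open>x = t * m - A\<close>, where \<open>exp A\<close> bounds the exponential moment: taking
  expectations gives \<open>t * E m \<le> A\<close>.\<close>

lemma expectation_Max_pair_form_le:
  fixes \<V> :: "(real^'n) set set"
  assumes \<V>: "finite \<V>" "\<V> \<noteq> {}" "\<And>V. V \<in> \<V> \<Longrightarrow> subspace V \<and> dim V = k" "k \<ge> 1"
    and S: "finite S" "S \<noteq> {}" "S \<subseteq> \<Union>\<V>" "\<And>v. v \<in> S \<Longrightarrow> norm v = 1"
  shows "integrable pair_gauss (\<lambda>g. Max (pair_form g ` S))"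
    and "(\<integral>g. Max (pair_form g ` S) \<partial>pair_gauss) \<le> sqrt (2 * real k) + sqrt (2 * ln (real (card \<V>)))"
proof -
  interpret prob_space "pair_gauss :: ('n set \<Rightarrow> real) measure" by (rule prob_space_pair_gauss)
  let ?m = "\<lambda>g. Max (pair_form g ` S)"
  have in_S: "?m g \<in> pair_form g ` S" for g using S by (intro Max_in) auto
  show int: "integrable pair_gauss ?m"
  proof (rule Bochner_Integration.integrable_bound)
    show "integrable pair_gauss (\<lambda>g. \<Sum>v\<in>S. \<bar>pair_form g v\<bar>)"
      by (intro Bochner_Integration.integrable_sum integrable_abs integrable_pair_form)
    have "\<bar>?m g\<bar> \<le> (\<Sum>v\<in>S. \<bar>pair_form g v\<bar>)" for g
      using in_S[of g] S(1) by (auto intro!: member_le_sum[of _ S "\<lambda>v. \<bar>pair_form g v\<bar>"])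
    then show "AE g in pair_gauss. norm (?m g) \<le> norm (\<Sum>v\<in>S. \<bar>pair_form g v\<bar>)"
      by (intro AE_I2) (simp add: sum_nonneg)
  qed (use S in measurable)
  define N where "N = real (card \<V>)"
  have N: "N \<ge> 1" using \<V> by (simp add: N_def Suc_le_eq card_gt_0_iff)
  have bound: "(\<integral>g. ?m g \<partial>pair_gauss) \<le> sqrt (2 * real k) + t / 2 + ln N / t" if t: "t > 0" for t
  proof -
    define A where "A = t * sqrt (2 * real k) + t\<^sup>2 / 2 + ln N"
    \<comment> \<open>\<open>Max\<close> of the empty set is unspecified, so subspaces that
      \<open>S\<close> misses are left out; this can only decrease the number of summands.\<close>
    define \<W> where "\<W> = {V \<in> \<V>. S \<inter> V \<noteq> {}}"
    have \<W>: "finite \<W>" "card \<W> \<le> card \<V>"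
      unfolding \<W>_def using \<V> by (auto intro: card_mono)
    let ?e = "\<lambda>V g. exp (t * Max (pair_form g ` (S \<inter> V)))"
    have ie: "integrable pair_gauss (?e V)" if "V \<in> \<W>" for V
      using that S by (intro integrable_exp_Max_pair_form) (auto simp: \<W>_def)
    have "(\<integral>g. exp (t * ?m g) \<partial>pair_gauss) \<le> (\<integral>g. (\<Sum>V\<in>\<W>. ?e V g) \<partial>pair_gauss)"
    proof (rule integral_mono)
      show "integrable pair_gauss (\<lambda>g. exp (t * ?m g))"
        by (rule integrable_exp_Max_pair_form[OF S(1,2)])
      show "integrable pair_gauss (\<lambda>g. \<Sum>V\<in>\<W>. ?e V g)"
        by (rule Bochner_Integration.integrable_sum[OF ie])
      fix g
      obtain v where v: "v \<in> S" "?m g = pair_form g v" using in_S by blast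
      then obtain V where V: "V \<in> \<V>" "v \<in> V" using S(3) by auto
      have "?m g \<le> Max (pair_form g ` (S \<inter> V))"
        unfolding v(2) using v V S(1) by (intro Max_ge) auto
      then have "exp (t * ?m g) \<le> ?e V g" using t by simp
      also have "\<dots> \<le> (\<Sum>V\<in>\<W>. ?e V g)"
        using v V \<W> by (intro member_le_sum[of V \<W> "\<lambda>V. ?e V g"]) (auto simp: \<W>_def)
      finally show "exp (t * ?m g) \<le> (\<Sum>V\<in>\<W>. ?e V g)" .
    qed
    also have "\<dots> = (\<Sum>V\<in>\<W>. \<integral>g. ?e V g \<partial>pair_gauss)"
      by (intro Bochner_Integration.integral_sum ie)
    also have "\<dots> \<le> (\<Sum>V\<in>\<W>. exp (t * sqrt (2 * real k) + t\<^sup>2 / 2))"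
    proof (rule sum_mono)
      fix V assume "V \<in> \<W>"
      then have V: "subspace V" "dim V = k" "S \<inter> V \<noteq> {}" using \<V>(3) by (auto simp: \<W>_def)
      show "(\<integral>g. ?e V g \<partial>pair_gauss) \<le> exp (t * sqrt (2 * real k) + t\<^sup>2 / 2)"
        by (rule expectation_exp_Max_pair_form_le[OF V(1,2) \<V>(4) finite_Int[OF disjI1[OF S(1)]] V(3) _ _ t])
           (use S(4) in auto)
    qed
    also have "\<dots> \<le> N * exp (t * sqrt (2 * real k) + t\<^sup>2 / 2)"
      using \<W> by (simp add: N_def)
    also have "\<dots> = exp A" using N by (simp add: A_def exp_add)
    finally have "(\<integral>g. exp (t * ?m g) \<partial>pair_gauss) \<le> exp A" .
    then have "(\<integral>g. exp (t * ?m g) * exp (- A) \<partial>pair_gauss) \<le> exp A * exp (- A)"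
      by simp
    moreover have "(\<integral>g. 1 + (t * ?m g - A) \<partial>pair_gauss) \<le> (\<integral>g. exp (t * ?m g) * exp (- A) \<partial>pair_gauss)"
    proof (rule integral_mono)
      show "1 + (t * ?m g - A) \<le> exp (t * ?m g) * exp (- A)" for g
        using exp_ge_add_one_self[of "t * ?m g - A"] by (simp add: exp_diff exp_minus field_simps)
      show "integrable pair_gauss (\<lambda>g. 1 + (t * ?m g - A))" using int by simp
      show "integrable pair_gauss (\<lambda>g. exp (t * ?m g) * exp (- A))"
        by (intro integrable_mult_left integrable_exp_Max_pair_form S(1,2))
    qed
    moreover have "(\<integral>g. 1 + (t * ?m g - A) \<partial>pair_gauss) = 1 + (t * (\<integral>g. ?m g \<partial>pair_gauss) - A)"
      using int by (simp add: prob_space)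
    ultimately have "t * (\<integral>g. ?m g \<partial>pair_gauss) \<le> A" by (simp flip: exp_add)
    then have "(\<integral>g. ?m g \<partial>pair_gauss) \<le> A / t" using t by (simp add: field_simps)
    also have "A / t = sqrt (2 * real k) + t / 2 + ln N / t"
      using t by (simp add: A_def field_simps power2_eq_square)
    finally show ?thesis .
  qed
  have "(\<integral>g. ?m g \<partial>pair_gauss) \<le> sqrt (2 * real k) + sqrt (2 * ln N)"
  proof (cases "N = 1")
    \<comment> \<open>Here the optimal \<open>t\<close> would be 0, which \<open>bound\<close>
      excludes; instead \<open>t = 2 * e\<close> is let tend to 0.\<close>
    case True
    have "(\<integral>g. ?m g \<partial>pair_gauss) \<le> sqrt (2 * real k)"
    proof (rule field_le_epsilon)
      show "(\<integral>g. ?m g \<partial>pair_gauss) \<le> sqrt (2 * real k) + e" if "e > 0" for e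
        using bound[of "2 * e"] that True by simp
    qed
    then show ?thesis using True by simp
  next
    case False
    define t where "t = sqrt (2 * ln N)"
    have "ln N > 0" using N False by simp
    then have t: "t > 0" "ln N = t\<^sup>2 / 2" by (simp_all add: t_def)
    show ?thesis
      using bound[OF t(1)] t(1) unfolding t_def[symmetric] t(2) by (simp add: power2_eq_square)
  qed
  then show "(\<integral>g. ?m g \<partial>pair_gauss) \<le> sqrt (2 * real k) + sqrt (2 * ln (real (card \<V>)))"
    by (simp add: N_def)
qed

section \<open>The dual cone\<close>

definition unit_vectors :: "(real^'n) set set \<Rightarrow> (real^'n) set" where
  "unit_vectors \<V> = {v \<in> \<Union>\<V>. norm v = 1}"

lemma quadratic_form_sum:
  fixes G :: "real^'n^'n"
  shows "v \<bullet> (G *v v) = (\<Sum>i\<in>UNIV. \<Sum>j\<in>UNIV. v $ i * v $ j * G $ i $ j)"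
  by (simp add: inner_vec_def matrix_vector_mult_def sum_distrib_left mult_ac)

text \<open>Coordinates of a unit vector are at most 1 in absolute value. The bound is independent
  of \<open>v\<close>: it makes suprema finite and later supplies an integrable majorant.\<close>

lemma abs_quadratic_form_le:
  fixes G :: "real^'n^'n"
  assumes "norm v = 1"
  shows "\<bar>v \<bullet> (G *v v)\<bar> \<le> (\<Sum>i\<in>UNIV. \<Sum>j\<in>UNIV. \<bar>G $ i $ j\<bar>)"
proof -
  have "\<bar>v $ i * v $ j * G $ i $ j\<bar> \<le> \<bar>G $ i $ j\<bar>" for i j
  proof -
    have "\<bar>v $ i\<bar> * \<bar>v $ j\<bar> \<le> 1 * 1"
      using component_le_norm_cart[of v] assms by (intro mult_mono) auto
    then show ?thesis
      using mult_right_mono[of "\<bar>v $ i\<bar> * \<bar>v $ j\<bar>" 1 "\<bar>G $ i $ j\<bar>"] by (simp add: abs_mult)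
  qed
  then show ?thesis
    unfolding quadratic_form_sum by (intro order.trans[OF sum_abs] sum_mono)
qed

lemma bdd_above_quadratic_form:
  "bdd_above ((\<lambda>v. v \<bullet> (G *v v)) ` unit_vectors \<V>)"
  using abs_quadratic_form_le[of _ G]
  by (intro bdd_aboveI2[where M = "\<Sum>i\<in>UNIV. \<Sum>j\<in>UNIV. \<bar>G $ i $ j\<bar>"]) (force simp: unit_vectors_def abs_le_iff)

lemma trace_matrix_mult:
  fixes A B :: "real^'n^'n"
  shows "trace (A ** B) = (\<Sum>i\<in>UNIV. \<Sum>j\<in>UNIV. A $ i $ j * B $ j $ i)"
  by (simp add: trace_def matrix_matrix_mult_def)

text \<open>Pairing with \<open>v v^T\<close> evaluates the quadratic form at \<open>v\<close>, so
  dual membership is the defining inequality of the cone. These matrices show that the supremum over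
  the dual slice is no smaller than the one over unit vectors.\<close>

lemma rank_one_mem_dual_cone:
  fixes v :: "real^'n"
  assumes "v \<in> unit_vectors \<V>"
  defines "Y \<equiv> (\<chi> i j. v $ i * v $ j) :: real^'n^'n"
  shows "Y \<in> dual_cone (kpsd_approx \<V>) \<inter> Hplane" and "tr_inner G Y = v \<bullet> (G *v v)"
proof -
  have tr: "tr_inner A Y = v \<bullet> (A *v v)" for A
    unfolding tr_inner_def trace_matrix_mult quadratic_form_sum Y_def by (simp add: mult_ac)
  then show "tr_inner G Y = v \<bullet> (G *v v)" .
  have "transpose Y = Y" by (simp add: Y_def transpose_def mult.commute)
  moreover have "trace Y = v \<bullet> v" by (simp add: trace_def Y_def inner_vec_def)
  ultimately show "Y \<in> dual_cone (kpsd_approx \<V>) \<inter> Hplane"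
    using assms(1) by (auto simp: dual_cone_def Hplane_def symmat_def kpsd_approx_def tr unit_vectors_def dot_square_norm)
qed

text \<open>With \<open>m\<close> the supremum of the quadratic form of \<open>G\<close>, the matrix \<open>m I - (G + G\<^sup>T) / 2\<close>
  lies in the cone, so pairing it with a dual element of unit trace gives the bound.\<close>

lemma dual_cone_tr_inner_le:
  fixes G :: "real^'n^'n"
  assumes \<V>: "\<And>V. V \<in> \<V> \<Longrightarrow> subspace V"
    and Y: "Y \<in> dual_cone (kpsd_approx \<V>) \<inter> Hplane"
  shows "tr_inner G Y \<le> (SUP v\<in>unit_vectors \<V>. v \<bullet> (G *v v))"
proof -
  define m where "m = (SUP v\<in>unit_vectors \<V>. v \<bullet> (G *v v))"
  \<comment> \<open>\<open>G\<close> may be asymmetric while the cone contains only symmetric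
    matrices; symmetrizing changes neither the quadratic form nor the pairing with a symmetric
    \<open>Y\<close>.\<close>
  define Z :: "real^'n^'n" where "Z = (\<chi> i j. m * (if i = j then 1 else 0) - (G $ i $ j + G $ j $ i) / 2)"
  have quad: "v \<bullet> (Z *v v) = m * (v \<bullet> v) - v \<bullet> (G *v v)" for v
  proof -
    have "(\<Sum>i\<in>UNIV. \<Sum>j\<in>UNIV. v $ i * v $ j * G $ j $ i) = v \<bullet> (G *v v)"
      unfolding quadratic_form_sum by (subst sum.swap) (simp add: mult_ac)
    moreover have "(\<Sum>i\<in>UNIV. \<Sum>j\<in>UNIV. v $ i * v $ j * (m * (if i = j then 1 else 0))) = m * (v \<bullet> v)"
      by (simp add: inner_vec_def sum_distrib_left mult_ac if_distrib cong: if_cong)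
    moreover have "v \<bullet> (Z *v v) = (\<Sum>i\<in>UNIV. \<Sum>j\<in>UNIV. v $ i * v $ j * (m * (if i = j then 1 else 0)))
        - ((\<Sum>i\<in>UNIV. \<Sum>j\<in>UNIV. v $ i * v $ j * G $ i $ j) + (\<Sum>i\<in>UNIV. \<Sum>j\<in>UNIV. v $ i * v $ j * G $ j $ i)) / 2"
      unfolding quadratic_form_sum[of v Z]
      by (simp add: Z_def right_diff_distrib sum_subtractf sum.distrib distrib_left add_divide_distrib sum_divide_distrib del: mult_cancel_left)
    ultimately show ?thesis using quadratic_form_sum[of v G] by simp
  qed
  have "Z \<in> kpsd_approx \<V>"
    unfolding kpsd_approx_def
  proof (intro CollectI conjI ballI)
    show "Z \<in> symmat" by (simp add: symmat_def Z_def transpose_def vec_eq_iff add.commute)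
    fix V v assume v: "V \<in> \<V>" "v \<in> V"
    show "0 \<le> v \<bullet> (Z *v v)"
    proof (cases "v = 0")
      case False
      define u where "u = (1 / norm v) *\<^sub>R v"
      have "u \<in> unit_vectors \<V>"
        unfolding unit_vectors_def u_def using v False \<V>[OF v(1)] by (auto intro: subspace_scale)
      then have "u \<bullet> (G *v u) \<le> m"
        unfolding m_def by (intro cSUP_upper bdd_above_quadratic_form)
      moreover have "v \<bullet> (G *v v) = (norm v)\<^sup>2 * (u \<bullet> (G *v u))"
        using False by (simp add: u_def matrix_vector_mult_scaleR power2_eq_square)
      ultimately have "v \<bullet> (G *v v) \<le> (norm v)\<^sup>2 * m"
        by (simp add: mult_left_mono)
      then show ?thesis unfolding quad by (simp add: dot_square_norm mult.commute)
    qed simp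
  qed
  then have "0 \<le> tr_inner Z Y" using Y by (auto simp: dual_cone_def)
  also have "tr_inner Z Y = m - tr_inner G Y"
  proof -
    have Yt: "Y $ j $ i = Y $ i $ j" for i j
      using Y by (auto simp: Hplane_def symmat_def transpose_def vec_eq_iff)
    have tY: "(\<Sum>i\<in>UNIV. Y $ i $ i) = 1" using Y by (auto simp: Hplane_def trace_def)
    have "(\<Sum>i\<in>UNIV. \<Sum>j\<in>UNIV. G $ j $ i * Y $ j $ i) = (\<Sum>i\<in>UNIV. \<Sum>j\<in>UNIV. G $ i $ j * Y $ j $ i)"
      by (subst sum.swap) (simp add: Yt)
    moreover have "(\<Sum>i\<in>UNIV. \<Sum>j\<in>UNIV. m * (if i = j then 1 else 0) * Y $ j $ i) = m"
    proof -
      have "(\<Sum>i\<in>UNIV. \<Sum>j\<in>UNIV. m * (if i = j then 1 else 0) * Y $ j $ i)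
          = (\<Sum>i\<in>UNIV. \<Sum>j\<in>UNIV. if i = j then m * Y $ j $ i else 0)"
        by (intro sum.cong refl) simp
      also have "\<dots> = m * (\<Sum>i\<in>UNIV. Y $ i $ i)" by (simp add: sum_distrib_left)
      finally show ?thesis using tY by simp
    qed
    moreover have "tr_inner Z Y = (\<Sum>i\<in>UNIV. \<Sum>j\<in>UNIV. m * (if i = j then 1 else 0) * Y $ j $ i)
       - ((\<Sum>i\<in>UNIV. \<Sum>j\<in>UNIV. G $ i $ j * Y $ j $ i) + (\<Sum>i\<in>UNIV. \<Sum>j\<in>UNIV. G $ j $ i * Y $ j $ i)) / 2"
      unfolding tr_inner_def trace_matrix_mult Z_def
      by (simp add: left_diff_distrib sum_subtractf sum.distrib distrib_right add_divide_distrib sum_divide_distrib)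
    ultimately show ?thesis by (simp add: tr_inner_def trace_matrix_mult)
  qed
  finally show ?thesis by (simp add: m_def)
qed

text \<open>Centering at \<open>I / n\<close> subtracts the constant \<open>Tr G / n\<close> from
  every pairing. Equality, rather than an upper bound, lets integrability of the width integrand be
  read off from the right-hand side.\<close>

lemma gauss_width_integrand_BH_dual:
  fixes G :: "real^'n^'n"
  assumes \<V>: "\<And>V. V \<in> \<V> \<Longrightarrow> subspace V" and ne: "unit_vectors \<V> \<noteq> {}"
  shows "gauss_width_integrand (BH (dual_cone (kpsd_approx \<V>))) G
    = (SUP v\<in>unit_vectors \<V>. v \<bullet> (G *v v)) - trace G / real CARD('n)"
proof -
  define D where "D = dual_cone (kpsd_approx \<V>) \<inter> Hplane"
  define m where "m = (SUP v\<in>unit_vectors \<V>. v \<bullet> (G *v v))"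
  have shift_scale: "tr_inner G (Y - c *\<^sub>R mat 1) = tr_inner G Y - c * trace G" for Y c
  proof -
    have "tr_inner G (Y - c *\<^sub>R mat 1)
        = (\<Sum>i\<in>UNIV. \<Sum>j\<in>UNIV. G $ i $ j * Y $ j $ i - (if j = i then c * G $ i $ j else 0))"
      unfolding tr_inner_def trace_matrix_mult
      by (intro sum.cong refl) (simp add: mat_def right_diff_distrib)
    then show ?thesis
      by (simp add: sum_subtractf tr_inner_def trace_matrix_mult trace_def[of G] sum_distrib_left)
  qed
  have shift: "tr_inner G (Y - (1 / real CARD('n)) *\<^sub>R mat 1) = tr_inner G Y - trace G / real CARD('n)" for Y
    unfolding shift_scale by simp
  have le: "tr_inner G Y \<le> m" if "Y \<in> D" for Y
    using dual_cone_tr_inner_le[OF \<V>] that by (simp add: D_def m_def)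
  have "D \<noteq> {}" using ne rank_one_mem_dual_cone(1) unfolding D_def by blast
  then have 1: "(SUP Y\<in>D. tr_inner G Y - trace G / real CARD('n)) \<le> m - trace G / real CARD('n)"
    using le by (intro cSUP_least) auto
  have bdd: "bdd_above ((\<lambda>Y. tr_inner G Y - trace G / real CARD('n)) ` D)"
    using le by (intro bdd_aboveI2[where M = "m - trace G / real CARD('n)"]) simp
  have "m \<le> (SUP Y\<in>D. tr_inner G Y - trace G / real CARD('n)) + trace G / real CARD('n)"
    unfolding m_def
  proof (rule cSUP_least[OF ne])
    fix v assume v: "v \<in> unit_vectors \<V>"
    show "v \<bullet> (G *v v) \<le> (SUP Y\<in>D. tr_inner G Y - trace G / real CARD('n)) + trace G / real CARD('n)"
      using cSUP_upper[OF _ bdd] rank_one_mem_dual_cone[OF v] by (fastforce simp: D_def)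
  qed
  with 1 show ?thesis
    unfolding gauss_width_integrand_def BH_def D_def[symmetric] m_def[symmetric] image_image shift by simp
qed

text \<open>If \<open>q v\<close> exceeds a level, so does \<open>q\<close> on a neighbourhood of
  \<open>v\<close>, which the dense sequence visits. This presents a supremum over an uncountable
  set as a limit of maxima, giving its measurability and carrying over the bound for finite
  sets.\<close>

lemma Max_dense_tendsto_SUP:
  fixes q :: "'a::metric_space \<Rightarrow> real"
  assumes q: "continuous_on UNIV q" "bdd_above (q ` U)"
    and d: "range d \<subseteq> U" "U \<subseteq> closure (range d)" "U \<noteq> {}"
  shows "(\<lambda>n. Max (q ` d ` {..n :: nat})) \<longlonglongrightarrow> (SUP v\<in>U. q v)"
proof (rule order_tendstoI)
  fix y assume "y < (SUP v\<in>U. q v)"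
  then obtain v where v: "v \<in> U" "y < q v" using less_cSUP_iff[OF d(3) q(2)] by blast
  have "open {x. y < q x}" using q(1) by (intro open_Collect_less) auto
  then have "{x. y < q x} \<inter> range d \<noteq> {}"
    using v d(2) open_Int_closure_eq_empty[of "{x. y < q x}" "range d"] by blast
  then obtain m where m: "y < q (d m)" by blast
  have "y < Max (q ` d ` {..n})" if "n \<ge> m" for n
    using m that by (subst Max_gr_iff) auto
  then show "\<forall>\<^sub>F n in sequentially. y < Max (q ` d ` {..n})"
    by (auto simp: eventually_sequentially)
next
  fix y assume y: "(SUP v\<in>U. q v) < y"
  have "Max (q ` d ` {..n}) < y" for n
    using d(1) y cSUP_upper[OF _ q(2)] by (subst Max_less_iff) (auto intro: le_less_trans)
  then show "\<forall>\<^sub>F n in sequentially. Max (q ` d ` {..n}) < y" by simp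
qed

text \<open>A non-integrable function has integral 0 by convention; the integrability conjunct rules
  out that the bound holds for this reason.\<close>

theorem theorem1:
  fixes \<V> :: "(real^'n) set set" and k :: nat
  assumes "1 \<le> k" and "k \<le> CARD('n)"
    and "finite \<V>" and "card \<V> \<ge> 1"
    and "\<And>V. V \<in> \<V> \<Longrightarrow> subspace V \<and> dim V = k"
  shows "integrable std_gauss_sym (gauss_width_integrand (BH (dual_cone (kpsd_approx \<V>))))
    \<and> gauss_width (BH (dual_cone (kpsd_approx \<V>)))
        \<le> sqrt (2 * real k) + sqrt (2 * ln (real (card \<V>)))"
proof -
  define U where "U = unit_vectors \<V>"
  have Vne: "\<V> \<noteq> {}" using assms(4) by auto
  have Une: "U \<noteq> {}"
  proof -
    obtain V where V: "V \<in> \<V>" using Vne by blast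
    then have "\<not> V \<subseteq> {0}" using assms(1,5) dim_eq_0[of V] by auto
    then obtain v where v: "v \<in> V" "v \<noteq> 0" by auto
    then have "(1 / norm v) *\<^sub>R v \<in> U"
      using V assms(5) by (auto simp: U_def unit_vectors_def intro: subspace_scale)
    then show ?thesis by blast
  qed
  \<comment> \<open>The dense set lies inside \<open>U\<close>, so each finite stage consists of
    unit vectors of the given subspaces.\<close>
  obtain D where D: "countable D" "D \<subseteq> U" "U \<subseteq> closure D" by (rule separable)
  then have Dne: "D \<noteq> {}" using Une by auto
  define d where "d = from_nat_into D"
  have d: "range d = D" unfolding d_def using D(1) Dne by (rule range_from_nat_into[rotated])
  define q where "q G v = v \<bullet> (G *v v)" for G :: "real^'n^'n" and v
  define F where "F n G = Max (q G ` d ` {..n})" for n :: nat and G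
  define T where "T G = (SUP v\<in>U. q G v)" for G
  define gm where "gm g = (\<chi> i j. g {i, j} :: real^'n^'n)" for g :: "'n set \<Rightarrow> real"
  have lim: "(\<lambda>n. F n G) \<longlonglongrightarrow> T G" for G
    unfolding F_def T_def
  proof (rule Max_dense_tendsto_SUP)
    show "continuous_on UNIV (q G)"
      unfolding q_def quadratic_form_sum by (intro continuous_intros)
    show "bdd_above (q G ` U)" unfolding q_def U_def by (rule bdd_above_quadratic_form)
  qed (use D d Une in auto)
  have F_meas: "F n \<in> borel_measurable borel" for n
  proof -
    have "continuous_on UNIV (\<lambda>G. q G v)" for v
      unfolding q_def quadratic_form_sum by (intro continuous_intros)
    then have "(\<lambda>G. q G v) \<in> borel_measurable borel" for v
      by (intro borel_measurable_continuous_onI)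
    then show ?thesis unfolding F_def by (intro borel_measurable_Max) auto
  qed
  have T_meas: "T \<in> borel_measurable borel"
    by (rule borel_measurable_LIMSEQ_real[OF lim F_meas])
  have gm_meas: "gm \<in> borel_measurable pair_gauss"
  proof (rule borel_measurable_euclidean_space[THEN iffD2], rule ballI)
    fix b :: "real^'n^'n" assume "b \<in> Basis"
    then obtain i j where "b = axis i (axis j 1)" by (auto simp: Basis_vec_def)
    then have "(\<lambda>g. gm g \<bullet> b) = (\<lambda>g. g {i, j})" by (simp add: gm_def inner_axis)
    then show "(\<lambda>g. gm g \<bullet> b) \<in> borel_measurable pair_gauss" by simp
  qed
  have std: "std_gauss_sym = distr pair_gauss borel gm"
    unfolding std_gauss_sym_def pair_gauss_def pairs_def gm_def ..
  have qgm: "q (gm g) v = pair_form g v" for g v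
    unfolding q_def quadratic_form_sum gm_def pair_form_def by simp
  have dU: "d n \<in> U" for n using d D(2) by auto
  have Fgm: "F n (gm g) = Max (pair_form g ` d ` {..n})" for n g
    unfolding F_def qgm ..
  let ?R = "sqrt (2 * real k) + sqrt (2 * ln (real (card \<V>)))"
  have F_le: "(\<integral>g. F n (gm g) \<partial>pair_gauss) \<le> ?R" for n
    unfolding Fgm using dU
    by (intro expectation_Max_pair_form_le(2)[OF assms(3) Vne assms(5,1)]) (auto simp: U_def unit_vectors_def)
  \<comment> \<open>The majorant for dominated convergence: it is independent of \<open>n\<close>
    and integrable as a finite sum of absolute entries.\<close>
  define w where "w g = (\<Sum>i\<in>UNIV. \<Sum>j\<in>UNIV. \<bar>g {i, j}\<bar>)" for g :: "'n set \<Rightarrow> real"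
  have w_int: "integrable pair_gauss w"
    unfolding w_def by (intro Bochner_Integration.integrable_sum integrable_abs integrable_pair_entry)
  have F_w: "\<bar>F n (gm g)\<bar> \<le> w g" for n g
  proof -
    have "F n (gm g) \<in> q (gm g) ` d ` {..n}" unfolding F_def by (intro Max_in) auto
    then obtain v where v: "v \<in> U" "F n (gm g) = q (gm g) v" using dU by auto
    then show ?thesis
      using abs_quadratic_form_le[of v "gm g"] by (simp add: q_def U_def unit_vectors_def w_def gm_def)
  qed
  note dominated = measurable_compose[OF gm_meas T_meas] measurable_compose[OF gm_meas F_meas] w_int lim F_w
  have T_int: "integrable pair_gauss (\<lambda>g. T (gm g))"
    by (rule integrable_dominated_convergence[where s = "\<lambda>n g. F n (gm g)" and w = w]) (simp_all add: dominated)
  have T_lim: "(\<lambda>n. \<integral>g. F n (gm g) \<partial>pair_gauss) \<longlonglongrightarrow> (\<integral>g. T (gm g) \<partial>pair_gauss)"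
    by (rule integral_dominated_convergence[where w = w]) (simp_all add: dominated)
  have T_le: "(\<integral>g. T (gm g) \<partial>pair_gauss) \<le> ?R"
    using F_le by (intro LIMSEQ_le_const2[OF T_lim]) auto
  have tr: "trace (gm g) = (\<Sum>i\<in>UNIV. g {i, i})" for g by (simp add: trace_def gm_def)
  have tr_int: "integrable pair_gauss (\<lambda>g. trace (gm g))"
    unfolding tr by (intro Bochner_Integration.integrable_sum integrable_pair_entry)
  \<comment> \<open>The centering term has mean zero, so it affects the integrand but not the
    width.\<close>
  have tr_0: "(\<integral>g. trace (gm g) \<partial>pair_gauss) = 0"
    unfolding tr by (subst Bochner_Integration.integral_sum) (simp_all only: integrable_pair_entry expectation_pair_entry sum.neutral_const)
  have gw: "gauss_width_integrand (BH (dual_cone (kpsd_approx \<V>))) = (\<lambda>G. T G - trace G / real CARD('n))"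
    using gauss_width_integrand_BH_dual[of \<V>] assms(5) Une by (auto simp: T_def q_def U_def)
  have gw_meas: "(\<lambda>G. T G - trace G / real CARD('n)) \<in> borel_measurable borel"
  proof -
    have "continuous_on UNIV (trace :: real^'n^'n \<Rightarrow> real)"
      unfolding trace_def by (intro continuous_intros)
    then have "(trace :: real^'n^'n \<Rightarrow> real) \<in> borel_measurable borel"
      by (rule borel_measurable_continuous_onI)
    then show ?thesis using T_meas by measurable
  qed
  show ?thesis
    unfolding gauss_width_def gw std integrable_distr_eq[OF gm_meas gw_meas] integral_distr[OF gm_meas gw_meas]
    using T_int T_le tr_int tr_0 by simp
qed

end
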